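(* Let $M\ge1$ and $N\ge 1$ be integers and let $\Lambda=\operatorname{diag}(\lambda_1,\dots,\lambda_M)$. Put $$c_{\Lambda,M}=(2\pi)^{-\frac{M^2}{2}}\prod_{i=1}^M\sqrt{\lambda_i}\prod_{1\le i<j\le M}(\lambda_i+\lambda_j).$$ Let $Z_N$ be the Kontsevich–Penner matrix model $$Z_N=c_{\Lambda,M}\,e^{-\frac13\operatorname{tr}\Lambda^3}\int_{\mathcal H_M}[\mathrm dH]\,e^{\frac16\operatorname{tr}H^3}e^{-\frac12\operatorname{tr}H\Lambda^2}\,\frac{\det(\Lambda)^N}{\det(-H)^N}.$$ For formal variables $s_0,s_1,s_2,\dots$ let $$\mathcal Z_N^{o,ext,s}=c_{\Lambda,M}\,e^{-\frac13\operatorname{tr}\Lambda^3}\int_{\mathcal H_M}[\mathrm dH]\,e^{\frac16\operatorname{tr}H^3}e^{-\frac12\operatorname{tr}H\Lambda^2}\;\frac1{(2\pi)^{N^2}}\int_{\mathcal M_N(\mathbb C)}[\mathrm dZ]\,e^{-\frac12\operatorname{tr}(Z\overline Z^t)}\,e^{\frac16\operatorname{tr}(Z^3)}\,\frac{\det\sqrt{\Lambda^2\otimes\mathrm{id}_N-\mathrm{id}_M\otimes\overline Z^t}}{\det(-H\otimes\mathrm{id}_N-\mathrm{id}_M\otimes Z)}\,\exp\left(\sum_{i\ge0}\frac{2^{-i-1}}{(i+1)!}s_i\operatorname{tr}(\overline Z^t)^{i+1}\right),$$ and let $$\mathcal Z_N^{o,ext}=\mathcal Z_N^{o,ext,s}\Big|_{s_i=2^i\,i!\,\operatorname{tr}\Lambda^{-2i-2},\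 i\ge0}.$$ Then $$Z_N=\mathcal Z_N^{o,ext}$$ as formal series in inverse powers of $\lambda_1,\dots,\lambda_M$.
   Context: Notation. $\mathcal H_M$ is the space of $M\times M$ Hermitian matrices with Lebesgue measure $[\mathrm dH]=\prod_i \mathrm dH_{ii}\prod_{i<j}\mathrm d\operatorname{Re}H_{ij}\,\mathrm d\operatorname{Im}H_{ij}$; $\mathcal M_N(\mathbb C)$ is the space of $N\times N$ complex matrices with Lebesgue measure $[\mathrm dZ]=\prod_{a,b}\mathrm d\operatorname{Re}Z_{ab}\,\mathrm d\operatorname{Im}Z_{ab}$; $\overline Z^t$ is the conjugate transpose; $\mathrm{id}_k$ is the $k\times k$ identity matrix; $\otimes$ is the Kronecker product. The determinant $\det\sqrt{\Lambda^2\otimes\mathrm{id}_N-\mathrm{id}_M\otimes\overline Z^t}$ is the formal power series in the entries of $\overline Z$ given by $\det(\Lambda)^N\exp\left(-\frac12\sum_{k\ge1}\frac1k\operatorname{tr}(\Lambda^{-2k})\operatorname{tr}\big((\overline Z^t)^k\big)\right)$. Meaning of the formal integrals. An expression $c_{\Lambda,M}e^{-\frac13\operatorname{tr}\Lambda^3}\int_{\mathcal H_M}[\mathrm dH]\,e^{\frac16\operatorname{tr}H^3}e^{-\frac12\operatorname{tr}H\Lambda^2}G(H)$ is understood after the substitution $H\to H-\Lambda$, i.e. as $$c_{\Lambda,M}\int_{\mathcal H_M}[\mathrm dH]\,e^{-\frac12\operatorname{tr}H^2\Lambda}\;e^{\frac16\operatorname{tr}H^3}\,G(H-\Lambda).$$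 Here $c_{\Lambda,M}e^{-\frac12\operatorname{tr}H^2\Lambda}[\mathrm dH]$ is a Gaussian probability measure (for $\lambda_i>0$). The remaining factors (in which $\det(-H)$ becomes $\det(\Lambda-H)$ and $\det(-H\otimes\mathrm{id}_N-\mathrm{id}_M\otimes Z)$ becomes $\det((\Lambda-H)\otimes\mathrm{id}_N-\mathrm{id}_M\otimes Z)$) are expanded as Taylor series in the entries of $H$, $Z$, $\overline Z$ around $0$, and integrated term by term. The integral over $\mathcal M_N(\mathbb C)$ is with respect to the Gaussian probability measure $(2\pi)^{-N^2}e^{-\frac12\operatorname{tr}(Z\overline Z^t)}[\mathrm dZ]$, so that for each entry $w=Z_{ab}$, independently of the other entries, $w^n\overline w^m$ integrates to $2^n n!\,\delta_{mn}$. The results are formal sums of homogeneous rational functions of $\lambda_1,\dots,\lambda_M$ with finitely many contributions in each homogeneity degree (for $\mathcal Z_N^{o,ext,s}$: for each monomial in the $s_i$ and each homogeneity degree). *)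

theory Defs
  imports
    "HOL-Analysis.Analysis"
    "HOL-Library.Multiset"
    "HOL-Library.Groups_Big_Fun"
    "HOL-Computational_Algebra.Formal_Laurent_Series"
begin

no_notation fps_nth (infixl \<open>$\<close> 75)

section \<open>Formal power series in an arbitrary set of variables\<close>

text \<open>A monomial is a finite multiset of variables, a series assigns a coefficient to every monomial.\<close>

typedef ('v, 'a) mfps = "UNIV :: ('v multiset \<Rightarrow> 'a) set"
  morphisms mcoeff Abs_mfps
  by simp

lemma mcoeff_Abs [simp]: "mcoeff (Abs_mfps f) m = f m"
  by (simp add: Abs_mfps_inverse)

lemma mfps_eqI: "(\<And>m. mcoeff f m = mcoeff g m) \<Longrightarrow> f = g"
  by (metis ext mcoeff_inject)

lemma finite_submultisets: "finite {a. a \<subseteq># (m :: 'v multiset)}"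
proof (induction m)
  case (add x m)
  have "{a. a \<subseteq># add_mset x m} \<subseteq> {a. a \<subseteq># m} \<union> add_mset x ` {a. a \<subseteq># m}"
  proof
    fix a assume a: "a \<in> {a. a \<subseteq># add_mset x m}"
    show "a \<in> {a. a \<subseteq># m} \<union> add_mset x ` {a. a \<subseteq># m}"
    proof (cases "x \<in># a")
      case True
      then obtain b where "a = add_mset x b" by (meson multi_member_split)
      then show ?thesis using a by auto
    next
      case False
      then show ?thesis using a
        by (metis (no_types, lifting) UnCI diff_single_trivial mem_Collect_eq subset_eq_diff_conv
            add_mset_add_single)
    qed
  qed
  then show ?case
    using add by (meson finite_Un finite_imageI finite_subset)
qed simp

instantiation mfps :: (type, comm_ring_1) comm_ring_1
begin

definition zero_mfps :: "('a, 'b) mfps" where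
  "0 = Abs_mfps (\<lambda>m. 0)"
definition one_mfps :: "('a, 'b) mfps" where
  "1 = Abs_mfps (\<lambda>m. if m = {#} then 1 else 0)"
definition plus_mfps :: "('a, 'b) mfps \<Rightarrow> ('a, 'b) mfps \<Rightarrow> ('a, 'b) mfps" where
  "f + g = Abs_mfps (\<lambda>m. mcoeff f m + mcoeff g m)"
definition uminus_mfps :: "('a, 'b) mfps \<Rightarrow> ('a, 'b) mfps" where
  "- f = Abs_mfps (\<lambda>m. - mcoeff f m)"
definition minus_mfps :: "('a, 'b) mfps \<Rightarrow> ('a, 'b) mfps \<Rightarrow> ('a, 'b) mfps" where
  "f - g = Abs_mfps (\<lambda>m. mcoeff f m - mcoeff g m)"
definition times_mfps :: "('a, 'b) mfps \<Rightarrow> ('a, 'b) mfps \<Rightarrow> ('a, 'b) mfps" where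
  "f * g = Abs_mfps (\<lambda>m. \<Sum>a\<in>{a. a \<subseteq># m}. mcoeff f a * mcoeff g (m - a))"

instance
proof
  fix f g h :: "('a, 'b) mfps"
  show "f * g * h = f * (g * h)"
  proof (rule mfps_eqI)
    fix m
    let ?S = "\<lambda>m :: 'a multiset. {a. a \<subseteq># m}"
    have "mcoeff (f * g * h) m =
        (\<Sum>a\<in>?S m. \<Sum>b\<in>?S a. mcoeff f b * mcoeff g (a - b) * mcoeff h (m - a))"
      by (simp add: times_mfps_def sum_distrib_right)
    also have "\<dots> = (\<Sum>(a,b)\<in>Sigma (?S m) ?S. mcoeff f b * mcoeff g (a - b) * mcoeff h (m - a))"
      by (rule sum.Sigma) (auto simp: finite_submultisets)
    also have "\<dots> = (\<Sum>(b,c)\<in>Sigma (?S m) (\<lambda>b. ?S (m - b)).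
        mcoeff f b * mcoeff g c * mcoeff h (m - b - c))"
    proof (rule sum.reindex_bij_witness[where i = "\<lambda>(b,c). (b + c, b)" and j = "\<lambda>(a,b). (b, a - b)"],
        goal_cases)
      case (2 x)
      have "b \<subseteq># m \<and> a - b \<subseteq># m - b" if "a \<subseteq># m" "b \<subseteq># a" for a b :: "'a multiset"
        using that unfolding subseteq_mset_def by (metis count_diff diff_le_mono order.trans)
      then show ?case using 2 by auto
    next
      case (4 y)
      have "b + c \<subseteq># m" if "b \<subseteq># m" "c \<subseteq># m - b" for b c :: "'a multiset"
        using that by (simp add: subset_mset.le_diff_conv2 add.commute)
      then show ?case using 4 by auto
    qed auto
    also have "\<dots> = (\<Sum>b\<in>?S m. \<Sum>c\<in>?S (m - b). mcoeff f b * mcoeff g c * mcoeff h (m - b - c))"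
      by (rule sum.Sigma[symmetric]) (auto simp: finite_submultisets)
    also have "\<dots> = mcoeff (f * (g * h)) m"
      by (simp add: times_mfps_def sum_distrib_left mult.assoc)
    finally show "mcoeff (f * g * h) m = mcoeff (f * (g * h)) m" .
  qed
  show "f * g = g * f"
  proof (rule mfps_eqI)
    fix m :: "'a multiset"
    have double_diff: "m - (m - a) = a" if "a \<subseteq># m" for a
      using that by (auto simp: multiset_eq_iff subseteq_mset_def)
    have "(\<Sum>a\<in>{a. a \<subseteq># m}. mcoeff f a * mcoeff g (m - a)) =
        (\<Sum>a\<in>{a. a \<subseteq># m}. mcoeff g a * mcoeff f (m - a))"
      by (rule sum.reindex_bij_witness[where i = "\<lambda>a. m - a" and j = "\<lambda>a. m - a"])
         (simp_all only: double_diff mem_Collect_eq diff_subset_eq_self mult.commute)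
    then show "mcoeff (f * g) m = mcoeff (g * f) m"
      by (simp add: times_mfps_def)
  qed
  show "1 * f = f"
  proof (rule mfps_eqI)
    fix m
    have "mcoeff (1 * f) m = (\<Sum>a\<in>{a. a \<subseteq># m}. if a = {#} then mcoeff f m else 0)"
      by (auto simp: times_mfps_def one_mfps_def intro!: sum.cong)
    then show "mcoeff (1 * f) m = mcoeff f m"
      by (simp add: sum.delta finite_submultisets)
  qed
  have "mcoeff (0 :: ('a, 'b) mfps) {#} \<noteq> mcoeff 1 {#}"
    by (simp add: zero_mfps_def one_mfps_def)
  then show "(0 :: ('a, 'b) mfps) \<noteq> 1" by auto
qed (rule mfps_eqI, simp add: plus_mfps_def zero_mfps_def uminus_mfps_def minus_mfps_def
    times_mfps_def add_ac distrib_right sum.distrib)+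

end

definition mconst :: "'a :: comm_ring_1 \<Rightarrow> ('v, 'a) mfps" where
  "mconst c = Abs_mfps (\<lambda>m. if m = {#} then c else 0)"

definition mvar :: "'v \<Rightarrow> ('v, 'a :: comm_ring_1) mfps" where
  "mvar v = Abs_mfps (\<lambda>m. if m = {#v#} then 1 else 0)"

text \<open>Infinite sums are taken coefficientwise; only finitely many members of the family may
  contribute to each coefficient.\<close>

definition mSum :: "('i \<Rightarrow> ('v, 'a :: comm_ring_1) mfps) \<Rightarrow> ('v, 'a) mfps" where
  "mSum F = Abs_mfps (\<lambda>m. Sum_any (\<lambda>i. mcoeff (F i) m))"

text \<open>The exponential is used for series without constant term only.\<close>

definition mexp :: "('v, 'a :: field) mfps \<Rightarrow> ('v, 'a) mfps" where
  "mexp f = mSum (\<lambda>k::nat. mconst (inverse (of_nat (fact k))) * f ^ k)"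

function minv_coeff :: "('v multiset \<Rightarrow> 'a :: field) \<Rightarrow> 'v multiset \<Rightarrow> 'a" where
  "minv_coeff f m = (if m = {#} then inverse (f {#})
     else - inverse (f {#}) * (\<Sum>a\<in>{a. a \<subset># m}. minv_coeff f a * f (m - a)))"
  by auto
termination
  by (relation "Wellfounded.measure (\<lambda>(f, m). size m)") (auto simp: mset_subset_size)

declare minv_coeff.simps [simp del]

instantiation mfps :: (type, field) inverse
begin

definition inverse_mfps :: "('a, 'b) mfps \<Rightarrow> ('a, 'b) mfps" where
  "inverse f = Abs_mfps (minv_coeff (mcoeff f))"
definition divide_mfps :: "('a, 'b) mfps \<Rightarrow> ('a, 'b) mfps \<Rightarrow> ('a, 'b) mfps" where
  "f div g = f * inverse g" for f g :: "('a, 'b) mfps"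

instance ..

end

lemma mfps_inverse_mult:
  fixes f :: "('v, 'a :: field) mfps"
  assumes "mcoeff f {#} \<noteq> 0"
  shows "inverse f * f = 1"
proof (rule mfps_eqI)
  fix m :: "'v multiset"
  have S: "{a. a \<subseteq># m} = insert m {a. a \<subset># m}"
    by (auto simp: subset_mset.le_less)
  have fin: "finite {a. a \<subset># m}"
    by (rule finite_subset[OF _ finite_submultisets[of m]]) (auto simp: subset_mset.le_less)
  have "mcoeff (inverse f * f) m = minv_coeff (mcoeff f) m * mcoeff f {#} +
      (\<Sum>a\<in>{a. a \<subset># m}. minv_coeff (mcoeff f) a * mcoeff f (m - a))"
    by (simp add: times_mfps_def inverse_mfps_def S fin)
  also have "\<dots> = mcoeff 1 m"
    using assms by (subst minv_coeff.simps) (auto simp: one_mfps_def)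
  finally show "mcoeff (inverse f * f) m = mcoeff 1 m" .
qed

section \<open>Matrices\<close>

type_synonym ('a, 'k) sqmat = "(('a, 'k) vec, 'k) vec"

definition diag_mat :: "('a :: zero, 'k :: finite) vec \<Rightarrow> ('a, 'k) sqmat" where
  "diag_mat v = (\<chi> i j. if i = j then v $ i else 0)"

definition var_mat :: "('k \<Rightarrow> 'k \<Rightarrow> 'v) \<Rightarrow> (('v, 'a :: comm_ring_1) mfps, 'k :: finite) sqmat" where
  "var_mat x = (\<chi> i j. mvar (x i j))"

primrec mat_pow :: "('a :: semiring_1, 'k :: finite) sqmat \<Rightarrow> nat \<Rightarrow> ('a, 'k) sqmat" where
  "mat_pow A 0 = mat 1"
| "mat_pow A (Suc k) = A ** mat_pow A k"

definition kron :: "('a :: times, 'm :: finite) sqmat \<Rightarrow> ('a, 'n :: finite) sqmat \<Rightarrow> ('a, 'm \<times> 'n) sqmat" where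
  "kron A B = (\<chi> p q. A $ fst p $ fst q * B $ snd p $ snd q)"

definition conj_transpose :: "(complex, 'n :: finite) sqmat \<Rightarrow> (complex, 'n) sqmat" where
  "conj_transpose A = (\<chi> i j. cnj (A $ j $ i))"

section \<open>Gaussian averages\<close>

text \<open>Real coordinates on the Hermitian matrices: the diagonal entries, the real parts of the
  entries above the diagonal (stored above the diagonal) and their imaginary parts (stored below).
  The image of \<^const>\<open>lborel\<close> under this map is the measure \<open>[dH]\<close>.\<close>

definition herm :: "(real, 'm :: {finite, linorder}) sqmat \<Rightarrow> (complex, 'm) sqmat" where
  "herm x = (\<chi> i j. if i = j then of_real (x $ i $ i)
     else if i < j then Complex (x $ i $ j) (x $ j $ i)
     else Complex (x $ j $ i) (- (x $ i $ j)))"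

definition c_norm :: "(real, 'm :: {finite, linorder}) vec \<Rightarrow> real" where
  "c_norm (l :: (real, 'm) vec) =
     (2 * pi) powr (- ((real CARD('m))\<^sup>2 / 2)) * (\<Prod>i\<in>UNIV. sqrt (l $ i)) *
     (\<Prod>(i, j)\<in>{(i, j). i < j}. l $ i + l $ j)"

definition H_avg ::
    "(real, 'm :: {finite, linorder}) vec \<Rightarrow> ((complex, 'm) sqmat \<Rightarrow> complex) \<Rightarrow> complex" where
  "H_avg l f =
     of_real (c_norm l) * (LINT x|lborel. (let H = herm x in
       exp (- (1/2) * trace (H ** H ** diag_mat (\<chi> i. of_real (l $ i)))) * f H))"

definition Z_avg :: "((complex, 'n :: finite) sqmat \<Rightarrow> complex) \<Rightarrow> complex" where
  "Z_avg (f :: (complex, 'n) sqmat \<Rightarrow> complex) =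
     of_real (inverse ((2 * pi) ^ (CARD('n)\<^sup>2))) *
     (LINT Z|lborel. exp (- (1/2) * trace (Z ** conj_transpose Z)) * f Z)"

subsection \<open>Homogeneity of the Hermitian averages in the parameters\<close>

lemma LINT_lborel_scale:
  fixes g :: "'a :: euclidean_space \<Rightarrow> complex"
  assumes [measurable]: "g \<in> borel_measurable borel" and "a \<noteq> 0"
  shows "(LINT x|lborel. g x) = of_real (\<bar>a\<bar> ^ DIM('a)) * (LINT x|lborel. g (a *\<^sub>R x))"
proof -
  have "(LINT x|lborel. g x) =
      (LINT x|density (distr lborel borel (\<lambda>x. 0 + a *\<^sub>R x)) (\<lambda>_. \<bar>a\<bar> ^ DIM('a)). g x)"
    using lborel_affine[OF \<open>a \<noteq> 0\<close>, of "0 :: 'a"] by simp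
  also have "\<dots> = (LINT x|distr lborel borel (\<lambda>x. 0 + a *\<^sub>R x). (\<bar>a\<bar> ^ DIM('a)) *\<^sub>R g x)"
    by (subst integral_density) auto
  also have "\<dots> = (LINT x|lborel. (\<bar>a\<bar> ^ DIM('a)) *\<^sub>R g (a *\<^sub>R x))"
    by (subst integral_distr) auto
  finally show ?thesis
    by (simp add: scaleR_conv_of_real)
qed

lemma herm_scale: "herm (a *\<^sub>R x) = a *\<^sub>R herm x"
  by (simp add: herm_def vec_eq_iff complex_eq_iff)

lemma herm_measurable [measurable]: "herm \<in> borel_measurable borel"
proof -
  have "continuous_on UNIV (herm :: (real, 'm :: {finite, linorder}) sqmat \<Rightarrow> (complex, 'm) sqmat)"
  proof (intro continuous_on_vec_lambda[where f = "\<lambda>i x. herm x $ i", simplified]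
        continuous_on_vec_lambda[where f = "\<lambda>j x. herm x $ i $ j" for i, simplified])
    fix i j :: 'm
    show "continuous_on UNIV (\<lambda>x :: (real, 'm) sqmat. herm x $ i $ j)"
      by (cases "i = j"; cases "i < j")
         (auto simp: herm_def Complex_eq intro!: continuous_intros)
  qed
  then show ?thesis by (rule borel_measurable_continuous_onI)
qed

lemma card_less_pairs: "2 * card {(i, j). i < (j :: 'm :: {finite, linorder})} + CARD('m) = (CARD('m))\<^sup>2"
proof -
  let ?L = "{(i, j). i < (j :: 'm)}" and ?G = "{(i, j). j < (i :: 'm)}"
  have "?G = prod.swap ` ?L" by auto
  then have G: "card ?G = card ?L" by (simp add: card_image)
  have D: "card (range (\<lambda>i :: 'm. (i, i))) = CARD('m)" by (simp add: card_image inj_on_def)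
  have "(UNIV :: ('m \<times> 'm) set) = (?L \<union> ?G) \<union> range (\<lambda>i. (i, i))"
    by (auto simp: image_iff)
  then have "CARD('m \<times> 'm) = card ((?L \<union> ?G) \<union> range (\<lambda>i. (i, i)))" by simp
  also have "\<dots> = card (?L \<union> ?G) + CARD('m)"
    by (subst card_Un_disjoint) (auto simp: D)
  also have "card (?L \<union> ?G) = card ?L + card ?L"
    by (subst card_Un_disjoint) (auto simp: G)
  finally show ?thesis by (simp add: power2_eq_square)
qed

lemma c_norm_scale:
  fixes l :: "real ^ ('m :: {finite, linorder})"
  assumes "c > 0"
  shows "c_norm (c *\<^sub>R l) = sqrt c ^ ((CARD('m))\<^sup>2) * c_norm l"
proof -
  have "(\<Prod>i\<in>UNIV. sqrt ((c *\<^sub>R l) $ i)) = sqrt c ^ CARD('m) * (\<Prod>i\<in>UNIV. sqrt (l $ i))"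
    by (simp add: real_sqrt_mult prod.distrib)
  moreover have "(\<Prod>(i, j)\<in>{(i, j). i < j}. (c *\<^sub>R l) $ i + (c *\<^sub>R l) $ j) =
      (\<Prod>(i, j)\<in>{(i, j). i < j}. c * (l $ i + l $ j))"
    by (simp add: algebra_simps)
  moreover have "\<dots> = c ^ card {(i, j). i < (j :: 'm)} * (\<Prod>(i, j)\<in>{(i, j). i < j}. l $ i + l $ j)"
    by (simp add: case_prod_unfold prod.distrib)
  moreover have "sqrt c ^ CARD('m) * c ^ card {(i, j). i < (j :: 'm)} = sqrt c ^ ((CARD('m))\<^sup>2)"
    using assms by (simp flip: card_less_pairs add: power_add power_mult)
  ultimately show ?thesis
    by (simp add: c_norm_def mult_ac flip: power2_eq_square)
qed

lemma matrix_scaleR_left: "(a *\<^sub>R A) ** B = a *\<^sub>R (A ** (B :: complex ^ 'k ^ 'm))"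
  by (simp add: matrix_matrix_mult_def vec_eq_iff scaleR_sum_right)

lemma matrix_scaleR_right: "A ** (a *\<^sub>R B) = a *\<^sub>R (A ** (B :: complex ^ 'k ^ 'm))"
  by (simp add: matrix_matrix_mult_def vec_eq_iff scaleR_sum_right)

lemma trace_scaleR: "trace (a *\<^sub>R (A :: complex ^ 'm ^ 'm)) = a *\<^sub>R trace A"
  by (simp add: trace_def scaleR_sum_right)

lemma gauss_measurable [measurable]:
  assumes [measurable]: "(f :: (complex, 'm :: {finite, linorder}) sqmat \<Rightarrow> complex) \<in> borel_measurable borel"
  shows "(\<lambda>x. exp (- (1/2) * trace (herm x ** herm x ** A)) * f (herm x)) \<in> borel_measurable borel"
proof -
  have "(\<lambda>H :: (complex, 'm) sqmat. exp (- (1/2) * trace (H ** H ** A))) \<in> borel_measurable borel"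
    unfolding trace_def matrix_matrix_mult_def vec_lambda_beta
    by (intro borel_measurable_continuous_onI continuous_intros; auto intro!: continuous_intros)
  then show ?thesis by measurable
qed

lemma H_avg_homogeneous:
  fixes l :: "real ^ ('m :: {finite, linorder})"
  assumes "c > 0" and f [measurable]: "f \<in> borel_measurable borel"
    and hom: "\<And>a H. f (a *\<^sub>R H) = a ^ n *\<^sub>R f H"
  shows "H_avg (c *\<^sub>R l) f = of_real (inverse (sqrt c) ^ n) * H_avg l f"
proof -
  let ?D = "diag_mat (\<chi> i. complex_of_real (l $ i))" and ?D' = "diag_mat (\<chi> i. complex_of_real ((c *\<^sub>R l) $ i))"
  let ?a = "inverse (sqrt c)"
  have a: "?a > 0" using \<open>c > 0\<close> by simp
  have D': "?D' = c *\<^sub>R ?D" by (simp add: diag_mat_def vec_eq_iff) (simp add: scaleR_conv_of_real)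
  have dim: "DIM((real, 'm) sqmat) = (CARD('m))\<^sup>2" by (simp add: power2_eq_square)
  have 1: "?a * ?a * c = 1" using \<open>c > 0\<close> by (simp add: field_simps flip: power2_eq_square)
  have tr: "trace (herm (?a *\<^sub>R x) ** herm (?a *\<^sub>R x) ** ?D') = trace (herm x ** herm x ** ?D)" for x
    using 1 by (simp only: D' herm_scale matrix_scaleR_left matrix_scaleR_right trace_scaleR
        scaleR_scaleR mult_ac scaleR_one)
  have "(LINT x|lborel. exp (- (1/2) * trace (herm x ** herm x ** ?D')) * f (herm x)) =
      of_real (\<bar>?a\<bar> ^ DIM((real, 'm) sqmat)) *
      (LINT x|lborel. exp (- (1/2) * trace (herm (?a *\<^sub>R x) ** herm (?a *\<^sub>R x) ** ?D')) * f (herm (?a *\<^sub>R x)))"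
    using a by (intro LINT_lborel_scale gauss_measurable f) auto
  also have "(\<lambda>x. exp (- (1/2) * trace (herm (?a *\<^sub>R x) ** herm (?a *\<^sub>R x) ** ?D')) * f (herm (?a *\<^sub>R x))) =
      (\<lambda>x. of_real (?a ^ n) * (exp (- (1/2) * trace (herm x ** herm x ** ?D)) * f (herm x)))"
    by (intro ext) (simp only: tr, simp only: herm_scale hom, simp add: scaleR_conv_of_real[where 'a = complex])
  finally have "H_avg (c *\<^sub>R l) f = of_real (c_norm (c *\<^sub>R l) * ?a ^ ((CARD('m))\<^sup>2)) * of_real (?a ^ n) *
      (LINT x|lborel. exp (- (1/2) * trace (herm x ** herm x ** ?D)) * f (herm x))"
    using a by (simp add: H_avg_def Let_def dim power2_eq_square)
  also have "c_norm (c *\<^sub>R l) * ?a ^ ((CARD('m))\<^sup>2) = c_norm l"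
    using \<open>c > 0\<close> by (simp add: c_norm_scale field_simps)
  finally show ?thesis by (simp add: H_avg_def Let_def)
qed

lemma H_avg_odd:
  fixes l :: "real ^ ('m :: {finite, linorder})"
  assumes f [measurable]: "f \<in> borel_measurable borel" and odd: "\<And>H. f (- H) = - f H"
  shows "H_avg l f = 0"
proof -
  let ?D = "diag_mat (\<chi> i. complex_of_real (l $ i))"
  let ?I = "LINT x|lborel. exp (- (1/2) * trace (herm x ** herm x ** ?D)) * f (herm x)"
  have m: "herm (- x) = - herm x" for x :: "(real, 'm) sqmat" using herm_scale[of "-1" x] by simp
  have mm: "(- H) ** (- H) = H ** H" for H :: "(complex, 'm) sqmat"
    by (simp add: matrix_matrix_mult_def)
  have "?I = of_real (\<bar>-1\<bar> ^ DIM((real, 'm) sqmat)) *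
      (LINT x|lborel. exp (- (1/2) * trace (herm (-1 *\<^sub>R x) ** herm (-1 *\<^sub>R x) ** ?D)) * f (herm (-1 *\<^sub>R x)))"
    by (intro LINT_lborel_scale gauss_measurable f) auto
  also have "\<dots> = - ?I" by (simp add: m mm odd)
  finally show ?thesis by (simp add: H_avg_def Let_def)
qed

section \<open>Formal integrals\<close>

text \<open>Formal sums of homogeneous functions of the parameters \<open>l $ i > 0\<close> are represented by formal
  Laurent series in a variable \<open>X\<close>: each parameter becomes \<open>l $ i * X\<^sup>-\<^sup>1\<close>, so that the coefficient of
  \<open>X ^ d\<close> is the value at \<open>l\<close> of the homogeneous component of degree \<open>- d\<close>.\<close>

definition lam :: "(real, 'm :: finite) vec \<Rightarrow> 'm \<Rightarrow> complex fls" where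
  "lam l i = fls_const (of_real (l $ i)) * fls_X_inv"

definition Lam :: "(real, 'm :: finite) vec \<Rightarrow> (('v, complex fls) mfps, 'm) sqmat" where
  "Lam l = diag_mat (\<chi> i. mconst (lam l i))"

definition tr_Lam_powi :: "(real, 'm :: finite) vec \<Rightarrow> int \<Rightarrow> complex fls" where
  "tr_Lam_powi l k = trace (diag_mat (\<chi> i. lam l i powi k))"

text \<open>Sum of a family with exponents bounded from below and finitely many contributions to each
  power of \<open>X\<close>.\<close>

definition fls_Sum :: "('i \<Rightarrow> complex fls) \<Rightarrow> complex fls" where
  "fls_Sum f = Abs_fls (\<lambda>d. Sum_any (\<lambda>i. fls_nth (f i) d))"

lemma fls_Sum_nth:
  assumes "\<And>i d. d < n \<Longrightarrow> fls_nth (f i) d = 0"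
  shows "fls_nth (fls_Sum f) d = Sum_any (\<lambda>i. fls_nth (f i) d)"
  unfolding fls_Sum_def by (rule nth_Abs_fls_lower_bound[of n]) (simp add: assms)

text \<open>An average of a function homogeneous of degree \<open>n\<close> in \<open>H\<close> is homogeneous of degree \<open>- n / 2\<close>
  in the parameters, and vanishes for odd \<open>n\<close> (see \<open>H_avg_homogeneous\<close> and \<open>H_avg_odd\<close>), hence the
  powers \<open>fls_X ^ (n div 2)\<close> below.\<close>

definition H_integral ::
    "(real, 'm :: {finite, linorder}) vec \<Rightarrow> ('m \<times> 'm, complex fls) mfps \<Rightarrow> complex fls" where
  "H_integral l F = fls_Sum (\<lambda>m.
     mcoeff F m * fls_const (H_avg l (\<lambda>H. \<Prod>(i, j)\<in>#m. H $ i $ j)) * fls_X ^ (size m div 2))"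

text \<open>The variables \<open>VZbar a b\<close> stand for the complex conjugates of the entries of \<open>Z\<close>.\<close>

datatype ('m, 'n) mat_var = is_VH: VH 'm 'm | VZ 'n 'n | VZbar 'n 'n

primrec mat_var_val :: "(complex, 'm :: finite) sqmat \<Rightarrow> (complex, 'n :: finite) sqmat \<Rightarrow>
    ('m, 'n) mat_var \<Rightarrow> complex" where
  "mat_var_val H Z (VH i j) = H $ i $ j"
| "mat_var_val H Z (VZ a b) = Z $ a $ b"
| "mat_var_val H Z (VZbar a b) = cnj (Z $ a $ b)"

text \<open>Integration over \<open>H\<close> and \<open>Z\<close> of a series in the entries of \<open>H\<close>, \<open>Z\<close>, \<open>Zbar\<close> (left summand)
  and in the formal variables \<open>s\<^sub>0, s\<^sub>1, \<dots>\<close> (right summand); the result is a series in the latter.\<close>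

definition HZ_integral ::
    "(real, 'm :: {finite, linorder}) vec \<Rightarrow>
      (('m, 'n :: finite) mat_var + nat, complex fls) mfps \<Rightarrow> (nat, complex fls) mfps" where
  "HZ_integral l F =
     Abs_mfps (\<lambda>s. fls_Sum (\<lambda>m.
       mcoeff F (image_mset Inl m + image_mset Inr s) *
       fls_const (H_avg l (\<lambda>H. Z_avg (\<lambda>Z. \<Prod>v\<in>#m. mat_var_val H Z v))) *
       fls_X ^ (size (filter_mset is_VH m) div 2)))"

text \<open>The non-Gaussian part of the integrand
  \<open>exp (1/6 tr H\<^sup>3) exp (- 1/2 tr H \<Lambda>\<^sup>2) G H\<close> after the substitution of \<open>H - \<Lambda>\<close> for \<open>H\<close>.\<close>

definition shifted_integrand :: "(real, 'm :: finite) vec \<Rightarrow> ('m \<Rightarrow> 'm \<Rightarrow> 'v) \<Rightarrow>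
    ((('v, complex fls) mfps, 'm) sqmat \<Rightarrow> ('v, complex fls) mfps) \<Rightarrow> ('v, complex fls) mfps" where
  "shifted_integrand l x G =
     mexp (mconst (1/6) * trace (mat_pow (var_mat x) 3)) * G (var_mat x - Lam l)"

definition Z_Kontsevich_Penner :: "nat \<Rightarrow> (real, 'm :: {finite, linorder}) vec \<Rightarrow> complex fls" where
  "Z_Kontsevich_Penner N l =
     H_integral l (shifted_integrand l Pair (\<lambda>H. det (Lam l) ^ N / det (- H) ^ N))"

definition det_sqrt :: "(real, 'm :: finite) vec \<Rightarrow>
    (('v, complex fls) mfps, 'n :: finite) sqmat \<Rightarrow> ('v, complex fls) mfps" where
  "det_sqrt (l :: (real, 'm) vec) (Zbar :: (('v, complex fls) mfps, 'n) sqmat) =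
     det (Lam l) ^ CARD('n) *
     mexp (- mconst (1/2) * mSum (\<lambda>k. if k \<ge> 1 then
       mconst (1 / of_nat k * tr_Lam_powi l (- 2 * int k)) * trace (mat_pow (transpose Zbar) k)
       else 0))"

definition Z_o_ext_s ::
    "'n :: finite itself \<Rightarrow> (real, 'm :: {finite, linorder}) vec \<Rightarrow> (nat, complex fls) mfps" where
  "Z_o_ext_s (_ :: 'n itself) (l :: (real, 'm) vec) =
     (let Z = var_mat (\<lambda>a b. Inl (VZ a b)) ::
              ((('m, 'n) mat_var + nat, complex fls) mfps, 'n) sqmat;
          Zbar = var_mat (\<lambda>a b. Inl (VZbar a b)) ::
              ((('m, 'n) mat_var + nat, complex fls) mfps, 'n) sqmat
      in HZ_integral l (shifted_integrand l (\<lambda>i j. Inl (VH i j)) (\<lambda>H.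
           mexp (mconst (1/6) * trace (mat_pow Z 3)) *
           (det_sqrt l Zbar / det (kron (- H) (mat 1) - kron (mat 1) Z)) *
           mexp (mSum (\<lambda>i. mconst (inverse (2 ^ (i + 1)) / of_nat (fact (i + 1))) *
             mvar (Inr i) * trace (mat_pow (transpose Zbar) (i + 1)))))))"

definition msubst :: "(nat \<Rightarrow> complex fls) \<Rightarrow> (nat, complex fls) mfps \<Rightarrow> complex fls" where
  "msubst v F = fls_Sum (\<lambda>s. mcoeff F s * (\<Prod>i\<in>#s. v i))"

definition Z_o_ext ::
    "'n :: finite itself \<Rightarrow> (real, 'm :: {finite, linorder}) vec \<Rightarrow> complex fls" where
  "Z_o_ext n l =
     msubst (\<lambda>i. 2 ^ i * of_nat (fact i) * tr_Lam_powi l (- 2 * int i - 2)) (Z_o_ext_s n l)"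

end

theory Submission
  imports Defs "HOL-Probability.Distributions"
begin

text \<open>At \<open>s\<^sub>i = 2\<^sup>i i! tr \<Lambda>\<^sup>-\<^sup>2\<^sup>i\<^sup>-\<^sup>2\<close> the last exponential of the integrand is the inverse of the exponential
  in the square root of the determinant, so that \<open>Zbar\<close> drops out of the integrand. By invariance of
  the Gaussian measure under \<open>Z \<mapsto> e\<^sup>i\<^sup>\<theta> Z\<close> only the part of the integrand of degree 0 in \<open>Z\<close> survives, where
  \<open>det (- H \<otimes> 1) = det (- H) ^ N\<close>. The substitution of the \<open>s\<^sub>i\<close> may be carried out before integrating,
  since bounds on the order in \<open>X\<close> leave only finitely many monomials for each power of \<open>X\<close>.\<close>

subsection \<open>Formal power series\<close>

text \<open>The cancellation is numerical:
  \<open>2 ^ i * i! / (2 ^ (i + 1) * (i + 1)!) = 1 / (2 * (i + 1))\<close>, the coefficient in the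
  exponent of the square root. The obstacle is to give each step a meaning, since neither
  substitution nor integration is a finite operation on arbitrary series. The factor
  \<open>exp (tr Z^3 / 6)\<close> contains no \<Lambda>, so its terms have unbounded degree but
  order 0 in \<open>X\<close>. Two gradings repair this. The degree in Zbar minus i + 1 for each
  \<open>s i\<close> makes the substitution a finite sum on every monomial in the matrix entries.
  The charge of a monomial under rotation of Z bounds the number of Z by the number of Zbar. Let a
  monomial have degree z in Zbar and h in H, and let S be the sum of i + 1 over its s variables. Its
  coefficient has order at least 2(z - S), the values of the s variables add 2S, and integration
  over H adds \<open>h div 2\<close>. The total 2z + \<open>h div 2\<close> no longer involves S and
  controls the degree h + 2z of a neutral monomial; together with S \<le> z this allows the sums
  over m and s to be exchanged.\<close>

lemma mcoeff_0 [simp]: "mcoeff 0 m = 0"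
  and mcoeff_1: "mcoeff 1 m = (if m = {#} then 1 else 0)"
  and mcoeff_add [simp]: "mcoeff (f + g) m = mcoeff f m + mcoeff g m"
  and mcoeff_uminus [simp]: "mcoeff (- f) m = - mcoeff f m"
  and mcoeff_diff [simp]: "mcoeff (f - g) m = mcoeff f m - mcoeff g m"
  and mcoeff_mult: "mcoeff (f * g) m = (\<Sum>a\<in>{a. a \<subseteq># m}. mcoeff f a * mcoeff g (m - a))"
  by (simp_all add: zero_mfps_def one_mfps_def plus_mfps_def uminus_mfps_def minus_mfps_def times_mfps_def)

lemma mcoeff_sum [simp]: "mcoeff (\<Sum>i\<in>I. f i) m = (\<Sum>i\<in>I. mcoeff (f i) m)"
  by (induction I rule: infinite_finite_induct) auto

lemma mcoeff_mconst: "mcoeff (mconst c) m = (if m = {#} then c else 0)"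
  by (simp add: mconst_def)

lemma mcoeff_mvar: "mcoeff (mvar v) m = (if m = {#v#} then 1 else 0)"
  by (simp add: mvar_def)

lemma mcoeff_mSum: "mcoeff (mSum F) m = Sum_any (\<lambda>i. mcoeff (F i) m)"
  by (simp add: mSum_def)

lemma mcoeff_mconst_mult [simp]: "mcoeff (mconst c * f) m = c * mcoeff f m"
proof -
  have "mcoeff (mconst c * f) m = (\<Sum>a\<in>{a. a \<subseteq># m}. if a = {#} then c * mcoeff f m else 0)"
    unfolding mcoeff_mult by (intro sum.cong) (auto simp: mcoeff_mconst)
  then show ?thesis
    by (simp add: sum.delta finite_submultisets)
qed

lemma mcoeff_mult_empty: "mcoeff (f * g) {#} = mcoeff f {#} * mcoeff g {#}"
  by (simp add: mcoeff_mult)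

lemma mconst_1: "mconst 1 = 1"
  and mconst_minus: "mconst (- a) = - mconst a"
  by (auto intro!: mfps_eqI simp: mcoeff_mconst mcoeff_1)

lemma mconst_mult: "mconst (a * b) = mconst a * mconst b"
  by (auto intro!: mfps_eqI simp: mcoeff_mconst)

lemma mcoeff_mult_pairs:
  "mcoeff (f * g) m = (\<Sum>(a, b)\<in>{(a, b). a + b = m}. mcoeff f a * mcoeff g b)"
  unfolding mcoeff_mult
  by (rule sum.reindex_bij_witness[where i = fst and j = "\<lambda>a. (a, m - a)"]) auto

lemma finite_sum_pairs: "finite {(a, b). a + b = (m :: 'v multiset)}"
  by (rule finite_subset[of _ "{a. a \<subseteq># m} \<times> {a. a \<subseteq># m}"]) (auto simp: finite_submultisets)

subsection \<open>Filtrations by weights\<close>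

text \<open>For \<open>e = 0\<close> this restricts the support, for \<open>e = 1\<close> it bounds the orders of the
  coefficients.\<close>

definition order_ge :: "nat \<Rightarrow> ('v \<Rightarrow> int) \<Rightarrow> int \<Rightarrow> ('v, 'a :: zero fls) mfps \<Rightarrow> bool" where
  "order_ge e w k f \<longleftrightarrow> (\<forall>m. mcoeff f m \<noteq> 0 \<longrightarrow>
     k \<le> (\<Sum>x\<in>#m. w x) + int e * fls_subdegree (mcoeff f m))"

lemma order_geI:
  "(\<And>m. mcoeff f m \<noteq> 0 \<Longrightarrow> k \<le> (\<Sum>x\<in>#m. w x) + int e * fls_subdegree (mcoeff f m)) \<Longrightarrow> order_ge e w k f"
  by (auto simp: order_ge_def)

lemma order_geD:
  "order_ge e w k f \<Longrightarrow> mcoeff f m \<noteq> 0 \<Longrightarrow> k \<le> (\<Sum>x\<in>#m. w x) + int e * fls_subdegree (mcoeff f m)"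
  by (auto simp: order_ge_def)

text \<open>Here 0 counts as having infinite order, although \<open>fls_subdegree 0 = 0\<close>;
  this makes the condition stable under sums in which terms cancel.\<close>

definition coeff_ge :: "nat \<Rightarrow> int \<Rightarrow> 'a :: zero fls \<Rightarrow> bool" where
  "coeff_ge e k c \<longleftrightarrow> (c \<noteq> 0 \<longrightarrow> k \<le> int e * fls_subdegree c)"

lemma order_ge_iff: "order_ge e w k f \<longleftrightarrow> (\<forall>m. coeff_ge e (k - (\<Sum>x\<in>#m. w x)) (mcoeff f m))"
  by (auto simp: order_ge_def coeff_ge_def algebra_simps)

lemma coeff_ge_0 [simp]: "coeff_ge e k 0"
  by (simp add: coeff_ge_def)

lemma coeff_ge_uminus [simp]: "coeff_ge e k (- c) \<longleftrightarrow> coeff_ge e k (c :: 'a :: ab_group_add fls)"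
  by (simp add: coeff_ge_def)

lemma coeff_ge_add:
  assumes "coeff_ge e k a" "coeff_ge e k b"
  shows "coeff_ge e k (a + b :: 'a :: ab_group_add fls)"
proof (cases "a = 0 \<or> b = 0 \<or> a + b = 0")
  case False
  then have "min (fls_subdegree a) (fls_subdegree b) \<le> fls_subdegree (a + b)"
    by (intro fls_plus_subdegree) auto
  then have "int e * min (fls_subdegree a) (fls_subdegree b) \<le> int e * fls_subdegree (a + b)"
    by (intro mult_left_mono) auto
  with False assms show ?thesis
    by (auto simp: coeff_ge_def min_def split: if_splits)
qed (use assms in auto)

lemma coeff_ge_sum:
  "(\<And>i. i \<in> I \<Longrightarrow> coeff_ge e k (c i)) \<Longrightarrow> coeff_ge e k (\<Sum>i\<in>I. c i :: 'a :: ab_group_add fls)"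
  by (induction I rule: infinite_finite_induct) (auto intro: coeff_ge_add)

lemma coeff_ge_mult:
  "coeff_ge e k a \<Longrightarrow> coeff_ge e j b \<Longrightarrow> coeff_ge e (k + j) (a * b :: 'a :: idom fls)"
  by (auto simp: coeff_ge_def distrib_left)

lemma coeff_ge_of_nat_inverse: "coeff_ge e 0 (inverse (of_nat n) :: 'a :: field fls)"
  by (auto simp: coeff_ge_def fls_inverse_subdegree)

lemma order_ge_0 [simp]: "order_ge e w k 0"
  and order_ge_uminus: "order_ge e w k f \<Longrightarrow> order_ge e w k (- f)"
  and order_ge_add: "order_ge e w k f \<Longrightarrow> order_ge e w k g \<Longrightarrow> order_ge e w k (f + g)"
  for f g :: "('v, 'a :: comm_ring_1 fls) mfps"
  by (auto simp: order_ge_iff intro: coeff_ge_add)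

lemma order_ge_diff:
  "order_ge e w k f \<Longrightarrow> order_ge e w k g \<Longrightarrow> order_ge e w k (f - g)"
  for f g :: "('v, 'a :: comm_ring_1 fls) mfps"
  using order_ge_add[OF _ order_ge_uminus, of e w k f g] by simp

lemma order_ge_mconst: "coeff_ge e k c \<Longrightarrow> order_ge e w k (mconst c)"
  for c :: "'a :: comm_ring_1 fls"
  by (auto simp: order_ge_iff mcoeff_mconst)

lemma order_ge_1: "order_ge e w 0 (1 :: ('v, 'a :: comm_ring_1 fls) mfps)"
  unfolding mconst_1[symmetric] by (rule order_ge_mconst) (simp add: coeff_ge_def)

lemma order_ge_mvar: "k \<le> w v \<Longrightarrow> order_ge e w k (mvar v :: ('v, 'a :: comm_ring_1 fls) mfps)"
  by (auto simp: order_ge_def mcoeff_mvar)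

lemma order_ge_sum:
  "(\<And>i. i \<in> I \<Longrightarrow> order_ge e w k (f i)) \<Longrightarrow> order_ge e w k (\<Sum>i\<in>I. f i)"
  for f :: "'i \<Rightarrow> ('v, 'a :: comm_ring_1 fls) mfps"
  by (auto simp: order_ge_iff intro: coeff_ge_sum)

lemma order_ge_mSum: "(\<And>i. order_ge e w k (f i)) \<Longrightarrow> order_ge e w k (mSum f)"
  for f :: "'i \<Rightarrow> ('v, 'a :: comm_ring_1 fls) mfps"
  by (auto simp: order_ge_iff mcoeff_mSum Sum_any.expand_set intro: coeff_ge_sum)

lemma order_ge_mult:
  fixes f g :: "('v, 'a :: idom fls) mfps"
  assumes "order_ge e w k f" "order_ge e w j g"
  shows "order_ge e w (k + j) (f * g)"
  unfolding order_ge_iff mcoeff_mult_pairs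
proof (intro allI coeff_ge_sum)
  fix m p assume "p \<in> {(a, b). a + b = (m :: 'v multiset)}"
  then obtain a b where p: "p = (a, b)" and m: "m = a + b" by auto
  have "coeff_ge e ((k - (\<Sum>x\<in>#a. w x)) + (j - (\<Sum>x\<in>#b. w x))) (mcoeff f a * mcoeff g b)"
    using assms unfolding order_ge_iff by (intro coeff_ge_mult) auto
  then show "coeff_ge e (k + j - (\<Sum>x\<in>#m. w x)) (case p of (a, b) \<Rightarrow> mcoeff f a * mcoeff g b)"
    by (simp add: p m algebra_simps)
qed

lemma order_ge_mult_0:
  "order_ge e w 0 f \<Longrightarrow> order_ge e w 0 g \<Longrightarrow> order_ge e w 0 (f * g)"
  for f g :: "('v, 'a :: idom fls) mfps"
  using order_ge_mult[of e w 0 f 0 g] by simp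

lemma order_ge_power: "order_ge e w k f \<Longrightarrow> order_ge e w (int n * k) (f ^ n)"
  for f :: "('v, 'a :: idom fls) mfps"
proof (induction n)
  case (Suc n)
  then show ?case using order_ge_mult[of e w k f "int n * k" "f ^ n"] by (simp add: algebra_simps)
qed (simp add: order_ge_1)

lemma order_ge_prod:
  assumes "\<And>i. i \<in> I \<Longrightarrow> order_ge e w k (f i :: ('v, 'a :: idom fls) mfps)"
  shows "order_ge e w (int (card I) * k) (\<Prod>i\<in>I. f i)"
  using assms
proof (induction I rule: infinite_finite_induct)
  case (insert i I)
  then have "order_ge e w (k + int (card I) * k) (f i * (\<Prod>i\<in>I. f i))"
    by (intro order_ge_mult) auto
  with insert.hyps show ?case by (simp add: algebra_simps)
qed (simp_all add: order_ge_1)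

lemma order_ge_det:
  fixes A :: "(('v, 'a :: idom fls) mfps, 'n :: finite) sqmat"
  assumes "\<And>i j. order_ge e w k (A $ i $ j)"
  shows "order_ge e w (int CARD('n) * k) (det A)"
  unfolding det_def
proof (intro order_ge_sum)
  fix p :: "'n \<Rightarrow> 'n"
  have "order_ge e w (int CARD('n) * k) (\<Prod>i\<in>UNIV. A $ i $ p i)"
    by (intro order_ge_prod assms)
  then show "order_ge e w (int CARD('n) * k) (of_int (sign p) * (\<Prod>i\<in>UNIV. A $ i $ p i))"
    by (auto simp: sign_def intro: order_ge_uminus)
qed

lemma order_ge_trace:
  fixes A :: "(('v, 'a :: idom fls) mfps, 'n :: finite) sqmat"
  shows "(\<And>i j. order_ge e w k (A $ i $ j)) \<Longrightarrow> order_ge e w k (trace A)"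
  unfolding trace_def by (intro order_ge_sum)

lemma order_ge_mat_pow:
  fixes A :: "(('v, 'a :: idom fls) mfps, 'n :: finite) sqmat"
  assumes "\<And>i j. order_ge e w k (A $ i $ j)"
  shows "order_ge e w (int r * k) (mat_pow A r $ i $ j)"
proof (induction r arbitrary: i j)
  case (Suc r)
  have "order_ge e w (k + int r * k) (\<Sum>q\<in>UNIV. A $ i $ q * mat_pow A r $ q $ j)"
    by (intro order_ge_sum order_ge_mult assms Suc.IH)
  then show ?case by (simp add: matrix_matrix_mult_def algebra_simps)
qed (simp add: mat_def order_ge_1)

lemma order_ge_mexp:
  fixes f :: "('v, 'a :: field fls) mfps"
  assumes "order_ge e w 0 f"
  shows "order_ge e w 0 (mexp f)"
  unfolding mexp_def
proof (intro order_ge_mSum order_ge_mult_0 order_ge_mconst)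
  fix k :: nat
  show "order_ge e w 0 (f ^ k)" using order_ge_power[OF assms, of k] by simp
  show "coeff_ge e 0 (inverse (of_nat (fact k)) :: 'a fls)"
    by (rule coeff_ge_of_nat_inverse)
qed

text \<open>The recursion \<open>minv_coeff\<close> refers to proper submonomials only, so the bound
  follows by induction on the size. For \<open>e = 1\<close> and a nonzero constant coefficient the
  two hypotheses force that coefficient to have order exactly \<open>k\<close>.\<close>

lemma order_ge_inverse:
  fixes f :: "('v, 'a :: field fls) mfps"
  assumes f: "order_ge e w k f" and f0: "coeff_ge e (- k) (inverse (mcoeff f {#}))"
  shows "order_ge e w (- k) (inverse f)"
proof -
  have "coeff_ge e (- k - (\<Sum>x\<in>#m. w x)) (minv_coeff (mcoeff f) m)" for m
  proof (induction m rule: measure_induct_rule[of size])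
    case (less m)
    have "coeff_ge e (- k + (- (\<Sum>x\<in>#m. w x)))
        (- inverse (mcoeff f {#}) * (\<Sum>a\<in>{a. a \<subset># m}. minv_coeff (mcoeff f) a * mcoeff f (m - a)))"
    proof (intro coeff_ge_mult coeff_ge_sum)
      show "coeff_ge e (- k) (- inverse (mcoeff f {#}))" using f0 by simp
      fix a assume "a \<in> {a. a \<subset># m}"
      then have a: "a \<subset># m" by simp
      then obtain b where m: "m = a + b" by (meson mset_subset_eq_exists_conv subset_mset.less_imp_le)
      have "coeff_ge e (- k - (\<Sum>x\<in>#a. w x)) (minv_coeff (mcoeff f) a)"
        using a by (intro less.IH mset_subset_size)
      moreover have "coeff_ge e (k - (\<Sum>x\<in>#b. w x)) (mcoeff f b)"
        using f by (simp add: order_ge_iff)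
      ultimately have "coeff_ge e ((- k - (\<Sum>x\<in>#a. w x)) + (k - (\<Sum>x\<in>#b. w x)))
          (minv_coeff (mcoeff f) a * mcoeff f b)"
        by (rule coeff_ge_mult)
      moreover have "(- k - (\<Sum>x\<in>#a. w x)) + (k - (\<Sum>x\<in>#b. w x)) = - (\<Sum>x\<in>#m. w x)"
        by (simp add: m)
      ultimately show "coeff_ge e (- (\<Sum>x\<in>#m. w x)) (minv_coeff (mcoeff f) a * mcoeff f (m - a))"
        by (simp add: m)
    qed
    then show ?case
      using f0 by (subst minv_coeff.simps) auto
  qed
  then show ?thesis by (simp add: order_ge_iff inverse_mfps_def)
qed

subsection \<open>The exponential\<close>

lemma order_ge_size_eq_0: "order_ge 0 (\<lambda>_. 1) k f \<Longrightarrow> int (size m) < k \<Longrightarrow> mcoeff f m = 0"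
  by (auto simp: order_ge_def sum_mset_constant)

lemma mcoeff_power_eq_0:
  fixes f :: "('v, 'a :: field fls) mfps"
  assumes "order_ge 0 (\<lambda>_. 1) 1 f" "size m < k"
  shows "mcoeff (f ^ k) m = 0"
  using order_ge_power[OF assms(1), of k] assms(2) by (intro order_ge_size_eq_0) auto

text \<open>All terms of \<open>f ^ k\<close> have degree at least \<open>k\<close>, so the
  exponential series stops at \<open>size m\<close>. The bound \<open>n\<close> is left free so that
  all submonomials of one monomial can share a range of summation.\<close>

lemma mcoeff_mexp:
  fixes f :: "('v, 'a :: field fls) mfps"
  assumes "order_ge 0 (\<lambda>_. 1) 1 f" "size m \<le> n"
  shows "mcoeff (mexp f) m = (\<Sum>k\<le>n. inverse (of_nat (fact k)) * mcoeff (f ^ k) m)"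
proof -
  have "{k. inverse (of_nat (fact k)) * mcoeff (f ^ k) m \<noteq> 0} \<subseteq> {..n}"
  proof
    fix k assume "k \<in> {k. inverse (of_nat (fact k)) * mcoeff (f ^ k) m \<noteq> 0}"
    then show "k \<in> {..n}" using mcoeff_power_eq_0[OF assms(1), of m k] assms(2) by force
  qed
  then show ?thesis
    unfolding mexp_def mcoeff_mSum mcoeff_mconst_mult by (rule Sum_any.expand_superset[rotated]) simp
qed

lemma mexp_0: "mexp 0 = (1 :: ('v, 'a :: field fls) mfps)"
proof (rule mfps_eqI)
  fix m :: "'v multiset"
  have "inverse (of_nat (fact k)) * mcoeff (0 ^ k) m = (if k = 0 then mcoeff 1 m else 0 :: 'a fls)" for k
    by (cases k) auto
  then have "mcoeff (mexp 0) m = (\<Sum>k\<le>size m. if k = 0 then mcoeff 1 m else 0 :: 'a fls)"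
    by (subst mcoeff_mexp[of _ _ "size m"]) simp_all
  then show "mcoeff (mexp 0) m = (mcoeff 1 m :: 'a fls)" by simp
qed

text \<open>Since \<open>f ^ i * g ^ j\<close> starts in degree \<open>i + j\<close>, the square of
  index pairs in the product of the truncated series may be cut down to a triangle, whose diagonals
  are given by the binomial theorem.\<close>

lemma mexp_add:
  fixes f g :: "('v, 'a :: field_char_0 fls) mfps"
  assumes f: "order_ge 0 (\<lambda>_. 1) 1 f" and g: "order_ge 0 (\<lambda>_. 1) 1 g"
  shows "mexp (f + g) = mexp f * mexp g"
proof (rule mfps_eqI)
  fix m :: "'v multiset"
  define n where "n = size m"
  define c :: "nat \<Rightarrow> 'a fls" where "c k = inverse (of_nat (fact k))" for k
  define u where "u i j = c i * c j * mcoeff (f ^ i * g ^ j) m" for i j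
  have cc: "c k * of_nat (k choose i) = c i * c (k - i)" if "i \<le> k" for i k
  proof -
    have "of_nat (k choose i) = (of_nat (fact k) / (of_nat (fact i) * of_nat (fact (k - i))) :: 'a fls)"
      using binomial_fact[OF that, where 'a = "'a fls"] by simp
    then show ?thesis by (simp add: c_def field_simps)
  qed
  have u0: "u i j = 0" if "n < i + j" for i j
  proof -
    have "order_ge 0 (\<lambda>_. 1) (int i * 1 + int j * 1) (f ^ i * g ^ j)"
      using f g by (intro order_ge_mult order_ge_power)
    with that show ?thesis by (simp add: u_def n_def order_ge_size_eq_0)
  qed
  have "mcoeff (mexp f * mexp g) m = (\<Sum>(a, b)\<in>{(a, b). a + b = m}.
      (\<Sum>i\<le>n. c i * mcoeff (f ^ i) a) * (\<Sum>j\<le>n. c j * mcoeff (g ^ j) b))"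
    unfolding mcoeff_mult_pairs
    by (intro sum.cong refl)
       (auto simp: n_def c_def mcoeff_mexp[OF f, of _ "size m"] mcoeff_mexp[OF g, of _ "size m"])
  also have "\<dots> = (\<Sum>(a, b)\<in>{(a, b). a + b = m}. \<Sum>i\<le>n. \<Sum>j\<le>n.
      c i * c j * (mcoeff (f ^ i) a * mcoeff (g ^ j) b))"
    by (intro sum.cong refl) (auto simp: sum_product mult_ac)
  also have "\<dots> = (\<Sum>i\<le>n. \<Sum>j\<le>n. u i j)"
    unfolding case_prod_unfold
    by (subst sum.swap, intro sum.cong refl, subst sum.swap)
       (simp add: u_def mcoeff_mult_pairs case_prod_unfold sum_distrib_left)
  also have "\<dots> = (\<Sum>(i, j)\<in>{..n} \<times> {..n}. u i j)"
    by (simp add: sum.cartesian_product)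
  also have "\<dots> = (\<Sum>(i, j)\<in>{(i, j). i + j \<le> n}. u i j)"
    by (rule sum.mono_neutral_right) (auto intro: u0)
  also have "\<dots> = (\<Sum>k\<le>n. \<Sum>i\<le>k. u i (k - i))"
    by (rule sum.triangle_reindex_eq)
  also have "\<dots> = (\<Sum>k\<le>n. c k * mcoeff ((f + g) ^ k) m)"
  proof (intro sum.cong refl)
    fix k
    have "mcoeff (of_nat (k choose i) * f ^ i * g ^ (k - i)) m =
        of_nat (k choose i) * mcoeff (f ^ i * g ^ (k - i)) m" for i
    proof -
      have "(of_nat r :: ('v, 'a fls) mfps) = mconst (of_nat r)" for r
        by (rule mfps_eqI, induction r) (auto simp: mcoeff_mconst mcoeff_1)
      then show ?thesis by (simp add: mult.assoc)
    qed
    then have "c k * mcoeff ((f + g) ^ k) m =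
        (\<Sum>i\<le>k. c k * of_nat (k choose i) * mcoeff (f ^ i * g ^ (k - i)) m)"
      by (simp add: binomial_ring sum_distrib_left mult.assoc)
    also have "\<dots> = (\<Sum>i\<le>k. u i (k - i))"
      by (intro sum.cong refl) (simp add: u_def cc)
    finally show "(\<Sum>i\<le>k. u i (k - i)) = c k * mcoeff ((f + g) ^ k) m" ..
  qed
  also have "\<dots> = mcoeff (mexp (f + g)) m"
    unfolding c_def n_def by (rule mcoeff_mexp[symmetric]) (auto intro: order_ge_add f g)
  finally show "mcoeff (mexp (f + g)) m = mcoeff (mexp f * mexp g) m" ..
qed

subsection \<open>Substitution homomorphisms\<close>

text \<open>Every variable \<open>x\<close> is replaced by \<open>c x\<close> times the monomial \<open>t x\<close>; this makes sense for series
  supported on the monomials of nonnegative weight, as long as only finitely many of those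
  contribute to each monomial of the result.\<close>

locale mfps_subst =
  fixes w :: "'v \<Rightarrow> int" and t :: "'v \<Rightarrow> 'u multiset" and c :: "'v \<Rightarrow> 'a :: field fls"
  assumes fin: "finite {M. 0 \<le> (\<Sum>x\<in>#M. w x) \<and> (\<Prod>x\<in>#M. c x) \<noteq> 0 \<and> (\<Sum>x\<in>#M. t x) = m}"
begin

definition preimage :: "'u multiset \<Rightarrow> 'v multiset set" where
  "preimage m = {M. 0 \<le> (\<Sum>x\<in>#M. w x) \<and> (\<Prod>x\<in>#M. c x) \<noteq> 0 \<and> (\<Sum>x\<in>#M. t x) = m}"

definition subst :: "('v, 'a fls) mfps \<Rightarrow> ('u, 'a fls) mfps" where
  "subst f = Abs_mfps (\<lambda>m. \<Sum>M\<in>preimage m. mcoeff f M * (\<Prod>x\<in>#M. c x))"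

lemma finite_preimage: "finite (preimage m)"
  unfolding preimage_def by (rule fin)

lemma mcoeff_subst: "mcoeff (subst f) m = (\<Sum>M\<in>preimage m. mcoeff f M * (\<Prod>x\<in>#M. c x))"
  by (simp add: subst_def)

lemma subst_0: "subst 0 = 0"
  and subst_add: "subst (f + g) = subst f + subst g"
  by (rule mfps_eqI; simp add: mcoeff_subst algebra_simps sum.distrib)+

lemma subst_mconst: "subst (mconst a) = mconst a"
proof (rule mfps_eqI)
  fix m :: "'u multiset"
  have "mcoeff (subst (mconst a)) m = (\<Sum>M\<in>preimage m. if M = {#} then a else 0)"
    unfolding mcoeff_subst by (intro sum.cong) (auto simp: mcoeff_mconst)
  also have "\<dots> = mcoeff (mconst a) m"
    by (simp add: finite_preimage) (auto simp: preimage_def mcoeff_mconst)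
  finally show "mcoeff (subst (mconst a)) m = mcoeff (mconst a) m" .
qed

lemma subst_1: "subst 1 = 1"
  using subst_mconst[of 1] by (simp add: mconst_1)

text \<open>A monomial of nonnegative weight may split into one factor of negative and one of
  positive weight, and \<open>preimage\<close> does not see the former. The hypotheses make the
  coefficients of such splittings vanish, so the reindexing only has to match the nonzero
  terms.\<close>

lemma subst_mult:
  assumes f: "order_ge 0 w 0 f" and g: "order_ge 0 w 0 g"
  shows "subst (f * g) = subst f * subst g"
proof (rule mfps_eqI)
  fix m :: "'u multiset"
  define u where "u a b = (mcoeff f a * (\<Prod>x\<in>#a. c x)) * (mcoeff g b * (\<Prod>x\<in>#b. c x))" for a b
  define S where "S = (SIGMA p:{(n, k). n + k = m}. preimage (fst p) \<times> preimage (snd p))"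
  have "mcoeff (subst (f * g)) m = (\<Sum>M\<in>preimage m. \<Sum>(a, b)\<in>{(a, b). a + b = M}. u a b)"
    unfolding mcoeff_subst
    by (intro sum.cong refl) (auto simp: mcoeff_mult_pairs sum_distrib_right u_def intro!: sum.cong)
  also have "\<dots> = (\<Sum>(M, a, b)\<in>(SIGMA M:preimage m. {(a, b). a + b = M}). u a b)"
    using finite_sum_pairs
    by (subst sum.Sigma) (auto simp: finite_preimage case_prod_unfold)
  also have "\<dots> = (\<Sum>(p, a, b)\<in>S. u a b)"
  proof (rule sum.reindex_bij_witness_not_neutral[
        where S' = "{(M, a, b). M = a + b \<and> M \<in> preimage m \<and> u a b = 0}"
          and T' = "{(p, a, b). (p, a, b) \<in> S \<and> u a b = 0}"
          and i = "\<lambda>(p, a, b). (a + b, a, b)"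
          and j = "\<lambda>(M, a, b). (((\<Sum>x\<in>#a. t x), (\<Sum>x\<in>#b. t x)), a, b)"], goal_cases)
    case 1
    show ?case
      by (rule finite_subset[of _ "(SIGMA M:preimage m. {(a, b). a + b = M})"])
         (auto simp: finite_preimage finite_sum_pairs)
  next
    case 2
    have "finite S"
      unfolding S_def by (intro finite_SigmaI finite_cartesian_product finite_sum_pairs finite_preimage)
    then show ?case by (rule finite_subset[rotated]) auto
  next
    case (4 x)
    then obtain M a b where x: "x = (M, a, b)" "M = a + b" "M \<in> preimage m" "u a b \<noteq> 0" by auto
    then have "mcoeff f a \<noteq> 0" "mcoeff g b \<noteq> 0" by (auto simp: u_def)
    then have "0 \<le> (\<Sum>x\<in>#a. w x)" "0 \<le> (\<Sum>x\<in>#b. w x)"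
      using order_geD[OF f, of a] order_geD[OF g, of b] by auto
    with x show ?case by (auto simp: S_def preimage_def)
  next
    case (5 y)
    then show ?case by (auto simp: S_def preimage_def)
  next
    case (6 y)
    then show ?case by (auto simp: S_def preimage_def)
  qed auto
  also have "\<dots> = (\<Sum>p\<in>{(n, k). n + k = m}. \<Sum>(a, b)\<in>preimage (fst p) \<times> preimage (snd p). u a b)"
    using finite_sum_pairs
    by (subst sum.Sigma) (auto simp: S_def finite_preimage case_prod_unfold)
  also have "\<dots> = mcoeff (subst f * subst g) m"
    unfolding mcoeff_mult_pairs mcoeff_subst
    by (intro sum.cong refl) (auto simp: sum_product sum.cartesian_product u_def)
  finally show "mcoeff (subst (f * g)) m = mcoeff (subst f * subst g) m" .
qed

lemma subst_power:
  assumes "order_ge 0 w 0 f"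
  shows "subst (f ^ k) = subst f ^ k"
proof (induction k)
  case (Suc k)
  have "order_ge 0 w 0 (f ^ k)" using order_ge_power[OF assms, of k] by simp
  with Suc assms show ?case by (simp add: subst_mult)
qed (simp add: subst_1)

lemma subst_mconst_mult: "subst (mconst a * f) = mconst a * subst f"
  by (rule mfps_eqI) (simp add: mcoeff_subst sum_distrib_left mult.assoc)

text \<open>Only the finitely many monomials in \<open>preimage m\<close> matter, and each of them
  meets finitely many members of the family; the finite index set \<open>I\<close> serves both
  sums.\<close>

lemma subst_mSum:
  assumes "\<And>M. finite {i. mcoeff (F i) M \<noteq> 0}"
  shows "subst (mSum F) = mSum (\<lambda>i. subst (F i))"
proof (rule mfps_eqI)
  fix m :: "'u multiset"
  define I where "I = (\<Union>M\<in>preimage m. {i. mcoeff (F i) M \<noteq> 0})"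
  have I: "finite I" unfolding I_def using assms by (intro finite_UN_I finite_preimage)
  have "mcoeff (subst (mSum F)) m = (\<Sum>M\<in>preimage m. (\<Sum>i\<in>I. mcoeff (F i) M) * (\<Prod>x\<in>#M. c x))"
    unfolding mcoeff_subst mcoeff_mSum
  proof (intro sum.cong refl arg_cong2[where f = "(*)"])
    fix M assume "M \<in> preimage m"
    with I show "Sum_any (\<lambda>i. mcoeff (F i) M) = (\<Sum>i\<in>I. mcoeff (F i) M)"
      by (intro Sum_any.expand_superset) (auto simp: I_def)
  qed
  also have "\<dots> = (\<Sum>i\<in>I. mcoeff (subst (F i)) m)"
    unfolding mcoeff_subst sum_distrib_right by (rule sum.swap)
  also have "\<dots> = Sum_any (\<lambda>i. mcoeff (subst (F i)) m)"
  proof (rule Sum_any.expand_superset[symmetric, OF I], safe)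
    fix i assume "mcoeff (subst (F i)) m \<noteq> 0"
    then obtain M where "M \<in> preimage m" "mcoeff (F i) M \<noteq> 0"
      unfolding mcoeff_subst by (metis (no_types, lifting) mult_zero_left sum.neutral)
    then show "i \<in> I" by (auto simp: I_def)
  qed
  finally show "mcoeff (subst (mSum F)) m = mcoeff (mSum (\<lambda>i. subst (F i))) m"
    by (simp add: mcoeff_mSum)
qed

lemma subst_mexp:
  assumes "order_ge 0 w 0 f" "order_ge 0 (\<lambda>_. 1) 1 f"
  shows "subst (mexp f) = mexp (subst f)"
proof -
  have "finite {k. mcoeff (mconst (inverse (of_nat (fact k))) * f ^ k) M \<noteq> 0}" for M
  proof (rule finite_subset)
    show "{k. mcoeff (mconst (inverse (of_nat (fact k))) * f ^ k) M \<noteq> 0} \<subseteq> {..size M}"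
      using mcoeff_power_eq_0[OF assms(2), of M] by (force simp: not_le[symmetric])
  qed simp
  then show ?thesis
    unfolding mexp_def
    by (subst subst_mSum) (auto simp: subst_mconst_mult subst_power[OF assms(1)] simp del: of_nat_fact)
qed

text \<open>By uniqueness of inverses, after applying \<open>subst\<close> to
  \<open>inverse f * f = 1\<close>. The inverse needs its own support condition because
  \<open>subst\<close> is multiplicative only on series of nonnegative weight.\<close>

lemma subst_inverse:
  assumes "order_ge 0 w 0 f" "order_ge 0 w 0 (inverse f)"
    and "mcoeff f {#} \<noteq> 0" "mcoeff (subst f) {#} \<noteq> 0"
  shows "subst (inverse f) = inverse (subst f)"
proof -
  have 1: "subst (inverse f) * subst f = 1"
    using subst_mult[OF assms(2,1)] by (simp add: mfps_inverse_mult assms(3) subst_1)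
  have 2: "subst f * inverse (subst f) = 1"
    using mfps_inverse_mult[OF assms(4)] by (simp add: mult.commute)
  have "subst (inverse f) = subst (inverse f) * (subst f * inverse (subst f))" by (simp add: 2)
  also have "\<dots> = inverse (subst f)" by (simp add: 1 flip: mult.assoc)
  finally show ?thesis .
qed

end

subsection \<open>Determinants\<close>

text \<open>Two maps have to be moved through determinants: the constant coefficient and the
  restriction to the variables of H.\<close>

locale comm_ring_1_hom =
  fixes h :: "'a :: comm_ring_1 \<Rightarrow> 'b :: comm_ring_1"
  assumes hom_1: "h 1 = 1" and hom_add: "h (x + y) = h x + h y" and hom_mult: "h (x * y) = h x * h y"
begin

lemma hom_0: "h 0 = 0"
  using hom_add[of 0 0] by simp

lemma hom_uminus: "h (- x) = - h x"
  using hom_add[of x "- x"] by (simp add: hom_0 add_eq_0_iff)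

lemma hom_diff: "h (x - y) = h x - h y"
  using hom_add[of x "- y"] by (simp add: hom_uminus)

lemma hom_sum: "h (sum f I) = (\<Sum>i\<in>I. h (f i))"
  by (induction I rule: infinite_finite_induct) (simp_all add: hom_0 hom_add)

lemma hom_prod: "h (prod f I) = (\<Prod>i\<in>I. h (f i))"
  by (induction I rule: infinite_finite_induct) (simp_all add: hom_1 hom_mult)

lemma hom_power: "h (x ^ n) = h x ^ n"
  by (induction n) (simp_all add: hom_1 hom_mult)

lemma hom_det: "h (det A) = det (\<chi> i j. h (A $ i $ j))" for A :: "('a, 'n :: finite) sqmat"
proof -
  have "h (of_int (sign p)) = of_int (sign p)" for p :: "'n \<Rightarrow> 'n"
    by (simp add: sign_def hom_1 hom_uminus)
  then show ?thesis by (simp add: det_def hom_sum hom_prod hom_mult)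
qed

lemma hom_mat_pow: "h (mat_pow A k $ i $ j) = mat_pow (\<chi> i j. h (A $ i $ j)) k $ i $ j"
  for A :: "('a, 'n :: finite) sqmat"
  by (induction k arbitrary: i j)
     (auto simp: mat_def hom_1 hom_0 matrix_matrix_mult_def hom_sum hom_mult)

lemma hom_trace_mat_pow: "h (trace (mat_pow A k)) = trace (mat_pow (\<chi> i j. h (A $ i $ j)) k)"
  for A :: "('a, 'n :: finite) sqmat"
  by (simp add: trace_def hom_sum hom_mat_pow)

end

interpretation mcoeff_empty: comm_ring_1_hom "\<lambda>f. mcoeff f {#}"
  by standard (simp_all add: mcoeff_1 mcoeff_mult_empty)

text \<open>In the Leibniz sum a permutation that moves a point outside \<open>B\<close> meets an
  off-diagonal zero. The permutations of \<open>B\<close> are the transports of those of the index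
  type of \<open>A\<close>, with the same sign.\<close>

lemma det_block_unit:
  fixes A :: "('a :: comm_ring_1, 'm :: finite) sqmat" and b :: "'n :: finite"
  shows "det (\<chi> p q :: 'm \<times> 'n. if snd p = b \<and> snd q = b then A $ fst p $ fst q
    else if p = q then 1 else 0) = det A"
proof -
  let ?E = "(\<chi> p q :: 'm \<times> 'n. if snd p = b \<and> snd q = b then A $ fst p $ fst q
    else if p = q then 1 else 0) :: ('a, 'm \<times> 'n) sqmat"
  define B where "B = range (\<lambda>i :: 'm. (i, b))"
  have bij: "bij_betw (\<lambda>i. (i, b)) UNIV B"
    by (auto simp: B_def bij_betw_def inj_on_def)
  have inB: "p \<in> B \<longleftrightarrow> snd p = b" for p by (cases p) (auto simp: B_def)
  define g where "g \<pi> x = (if x \<in> B then (\<pi> (inv_into UNIV (\<lambda>i. (i, b)) x), b) else x)"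
    for \<pi> :: "'m \<Rightarrow> 'm" and x :: "'m \<times> 'n"
  have g: "bij_betw g {\<pi>. \<pi> permutes UNIV} {\<pi>. \<pi> permutes B}"
    using bij_betw_permutations[OF bij] unfolding g_def by simp
  have inv: "inv_into UNIV (\<lambda>i. (i, b)) (i, b) = i" for i :: 'm
    by (rule inv_into_f_f) (auto simp: inj_on_def)
  have gb: "g \<pi> (i, b) = (\<pi> i, b)" for \<pi> i by (simp add: g_def inB inv)
  have "g \<pi> = map_permutation UNIV (\<lambda>i. (i, b)) \<pi>" for \<pi>
    by (auto simp: g_def map_permutation_def restrict_id_def B_def fun_eq_iff)
  then have sgn: "sign (g \<pi>) = sign \<pi>" if "\<pi> permutes UNIV" for \<pi>
    using that by (simp add: sign_map_permutation inj_on_def)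
  have supp: "\<pi> permutes B" if \<pi>: "\<pi> permutes UNIV" and nz: "(\<Prod>p\<in>UNIV. ?E $ p $ \<pi> p) \<noteq> 0" for \<pi>
  proof -
    have "\<pi> p = p" if "p \<notin> B" for p
    proof -
      have "?E $ p $ \<pi> p \<noteq> 0" using nz by (metis (lifting) UNIV_I finite prod_zero)
      with that show ?thesis by (auto simp: inB split: if_splits)
    qed
    with \<pi> show ?thesis by (auto intro: permutes_superset)
  qed
  have "det ?E = (\<Sum>\<pi>\<in>{\<pi>. \<pi> permutes B}. of_int (sign \<pi>) * (\<Prod>p\<in>UNIV. ?E $ p $ \<pi> p))"
    unfolding det_def
  proof (rule sum.mono_neutral_right)
    show "{\<pi>. \<pi> permutes B} \<subseteq> {\<pi>. \<pi> permutes UNIV}" by (auto intro: permutes_subset)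
    show "\<forall>\<pi>\<in>{\<pi>. \<pi> permutes UNIV} - {\<pi>. \<pi> permutes B}.
        of_int (sign \<pi>) * (\<Prod>p\<in>UNIV. ?E $ p $ \<pi> p) = 0"
      using supp by (metis (no_types, lifting) DiffE mem_Collect_eq mult_zero_right)
  qed (rule finite_permutations[OF finite])
  also have "\<dots> = (\<Sum>\<pi>\<in>{\<pi>. \<pi> permutes UNIV}. of_int (sign (g \<pi>)) * (\<Prod>p\<in>UNIV. ?E $ p $ g \<pi> p))"
    by (rule sum.reindex_bij_betw[OF g, symmetric])
  also have "\<dots> = (\<Sum>\<pi>\<in>{\<pi>. \<pi> permutes UNIV}. of_int (sign \<pi>) * (\<Prod>i\<in>UNIV. A $ i $ \<pi> i))"
  proof (intro sum.cong refl arg_cong2[where f = "(*)"])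
    fix \<pi> :: "'m \<Rightarrow> 'm" assume "\<pi> \<in> {\<pi>. \<pi> permutes UNIV}"
    then show "of_int (sign (g \<pi>)) = (of_int (sign \<pi>) :: 'a)" by (simp add: sgn)
    have "(\<Prod>p\<in>UNIV. ?E $ p $ g \<pi> p) = (\<Prod>p\<in>B. ?E $ p $ g \<pi> p)"
      by (rule prod.mono_neutral_right) (auto simp: inB g_def)
    also have "\<dots> = (\<Prod>i\<in>UNIV. ?E $ (i, b) $ g \<pi> (i, b))"
      by (rule prod.reindex_bij_betw[OF bij, symmetric])
    finally show "(\<Prod>p\<in>UNIV. ?E $ p $ g \<pi> p) = (\<Prod>i\<in>UNIV. A $ i $ \<pi> i)"
      by (simp add: gb)
  qed
  finally show ?thesis by (simp add: det_def)
qed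

text \<open>\<open>A \<otimes> 1\<close> is the product of the commuting matrices that act by \<open>A\<close> on a single copy.\<close>

lemma det_kron_mat_1:
  fixes A :: "('a :: comm_ring_1, 'm :: finite) sqmat"
  shows "det (kron A (mat 1 :: ('a, 'n :: finite) sqmat)) = det A ^ CARD('n)"
proof -
  define E :: "'n set \<Rightarrow> ('a, 'm \<times> 'n) sqmat" where
    "E S = (\<chi> p q. if snd p = snd q \<and> snd p \<in> S then A $ fst p $ fst q else if p = q then 1 else 0)" for S
  have "det (E S) = det A ^ card S" if "finite S" for S
    using that
  proof (induction S)
    case empty
    have "E {} = mat 1" by (simp add: E_def mat_def vec_eq_iff)
    then show ?case by simp
  next
    case (insert b S)
    have "E (insert b S) = E {b} ** E S"
    proof (simp add: vec_eq_iff, intro allI)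
      fix i :: 'm and c :: 'n and j :: 'm and d :: 'n
      show "E (insert b S) $ (i, c) $ (j, d) = (E {b} ** E S) $ (i, c) $ (j, d)"
      \<comment> \<open>If \<open>c = b\<close>, the row of \<open>E {b}\<close> leads only to
        points of copy \<open>b\<close>, where \<open>E S\<close> is the identity because b \<notin>
        S; only \<open>p = (j, d)\<close> can contribute. Otherwise the row of \<open>E {b}\<close>
        is that of the identity and only \<open>p = (i, c)\<close> contributes.\<close>
      proof (cases "c = b")
        case True
        have "(E {b} ** E S) $ (i, c) $ (j, d) = (\<Sum>p\<in>UNIV. E {b} $ (i, c) $ p * E S $ p $ (j, d))"
          by (simp add: matrix_matrix_mult_def)
        also have "\<dots> = (\<Sum>p\<in>{(j, d)}. E {b} $ (i, c) $ p * E S $ p $ (j, d))"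
          using insert.hyps True by (intro sum.mono_neutral_right) (auto simp: E_def)
        also have "\<dots> = E (insert b S) $ (i, c) $ (j, d)"
          using insert.hyps True by (auto simp: E_def)
        finally show ?thesis ..
      next
        case False
        have "(E {b} ** E S) $ (i, c) $ (j, d) = (\<Sum>p\<in>UNIV. E {b} $ (i, c) $ p * E S $ p $ (j, d))"
          by (simp add: matrix_matrix_mult_def)
        also have "\<dots> = (\<Sum>p\<in>{(i, c)}. E {b} $ (i, c) $ p * E S $ p $ (j, d))"
          using False by (intro sum.mono_neutral_right) (auto simp: E_def)
        also have "\<dots> = E (insert b S) $ (i, c) $ (j, d)"
          using False by (auto simp: E_def)
        finally show ?thesis ..
      qed
    qed
    moreover have "E {b} = (\<chi> p q. if snd p = b \<and> snd q = b then A $ fst p $ fst q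
        else if p = q then 1 else 0)"
      by (auto simp: E_def vec_eq_iff)
    ultimately show ?case
      using insert by (simp add: det_mul det_block_unit)
  qed
  from this[of UNIV] have "det (E UNIV) = det A ^ CARD('n)" by simp
  moreover have "E UNIV = kron A (mat 1)"
    by (auto simp: E_def kron_def mat_def vec_eq_iff)
  ultimately show ?thesis by simp
qed

subsection \<open>The Gaussian average over complex matrices\<close>

text \<open>The image of \<^const>\<open>lborel\<close> is invariant under translations, hence a multiple of
  \<^const>\<open>lborel\<close>, and the unit ball shows that the factor is 1.\<close>

lemma lborel_distr_isometry:
  fixes T :: "'a :: euclidean_space \<Rightarrow> 'a"
  assumes lin: "linear T" and norm: "\<And>x. norm (T x) = norm x"
  shows "distr lborel borel T = lborel"
proof (rule measure_eqI)
  fix B assume "B \<in> sets (distr lborel borel T)"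
  then have B [measurable]: "B \<in> sets borel" by simp
  let ?U = "ball 0 1 :: 'a set"
  have U [measurable]: "?U \<in> sets borel" by simp
  have U' [measurable]: "(indicator ?U :: 'a \<Rightarrow> ennreal) \<in> borel_measurable borel"
    by (rule borel_measurable_indicator) (rule U)
  interpret T: linear T by fact
  have inj: "inj T"
    by (metis T.diff injI norm norm_eq_zero right_minus_eq)
  have surj: "surj T" using lin inj by (rule linear_inj_imp_surj)
  have [measurable]: "T \<in> borel_measurable borel"
    using lin by (intro borel_measurable_continuous_onI linear_continuous_on) (simp add: linear_linear)
  have shift: "(\<integral>\<^sup>+x. g (z + x) \<partial>lborel) = (\<integral>\<^sup>+x. g x \<partial>lborel)"
    if [measurable]: "g \<in> borel_measurable borel" for g :: "'a \<Rightarrow> ennreal" and z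
  proof -
    have "(\<integral>\<^sup>+x. g x \<partial>lborel) = (\<integral>\<^sup>+x. g x \<partial>distr lborel borel ((+) z))"
      by (simp add: lborel_distr_plus)
    also have "\<dots> = (\<integral>\<^sup>+x. g (z + x) \<partial>lborel)"
      by (rule nn_integral_distr) auto
    finally show ?thesis ..
  qed
  have 1: "(\<integral>\<^sup>+y. indicator B (T y + x) \<partial>lborel) = (\<integral>\<^sup>+y. indicator B (T y) \<partial>lborel)" for x
  proof -
    obtain z where z: "x = T z" using surj by blast
    show ?thesis using shift[of "\<lambda>y. indicator B (T y)" z] by (simp add: z T.add add.commute)
  qed
  have 2: "(\<integral>\<^sup>+y. indicator ?U (x - T y) \<partial>lborel) = emeasure lborel ?U" for x
  proof -
    obtain z where z: "x = T z" using surj by blast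
    have "indicator ?U (x - T y) = (indicator ?U (- z + y) :: ennreal)" for y
      by (simp add: z T.diff[symmetric] norm indicator_def norm_minus_commute)
    then have "(\<integral>\<^sup>+y. indicator ?U (x - T y) \<partial>lborel) = (\<integral>\<^sup>+y. indicator ?U (- z + y) \<partial>lborel)"
      by simp
    also have "\<dots> = (\<integral>\<^sup>+y. indicator ?U y \<partial>lborel)"
      by (rule shift) measurable
    finally show ?thesis by simp
  qed
  \<comment> \<open>Both measures come from the double integral of
    \<open>indicator ?U x * indicator B (T y + x)\<close>. Integrating over \<open>y\<close> for
    fixed \<open>x\<close> gives the image measure of \<open>B\<close>, by \<open>1\<close>.
    Translating \<open>x\<close> by \<open>T y\<close> moves the shift into the ball, where
    \<open>2\<close> yields its volume.\<close>
  have "emeasure lborel ?U * emeasure (distr lborel borel T) B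
      = (\<integral>\<^sup>+x. indicator ?U x * (\<integral>\<^sup>+y. indicator B (T y) \<partial>lborel) \<partial>lborel)"
  proof -
    have "emeasure (distr lborel borel T) B = (\<integral>\<^sup>+y. indicator B y \<partial>distr lborel borel T)"
      by simp
    also have "\<dots> = (\<integral>\<^sup>+y. indicator B (T y) \<partial>lborel)"
      by (rule nn_integral_distr) auto
    finally show ?thesis by (subst nn_integral_multc) auto
  qed
  also have "\<dots> = (\<integral>\<^sup>+x. \<integral>\<^sup>+y. indicator ?U x * indicator B (T y + x) \<partial>lborel \<partial>lborel)"
    by (simp add: nn_integral_cmult 1)
  also have "\<dots> = (\<integral>\<^sup>+y. \<integral>\<^sup>+x. indicator ?U x * indicator B (T y + x) \<partial>lborel \<partial>lborel)"
  proof (rule lborel_pair.Fubini')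
    have "(\<lambda>(y, x). indicator ?U x * indicator B (T y + x) :: ennreal) \<in> borel_measurable (borel \<Otimes>\<^sub>M borel)"
      by measurable
    then show "(\<lambda>(y, x). indicator ?U x * indicator B (T y + x) :: ennreal) \<in> borel_measurable (lborel \<Otimes>\<^sub>M lborel)"
      by (simp cong: measurable_cong_sets sets_pair_measure_cong)
  qed
  also have "\<dots> = (\<integral>\<^sup>+y. \<integral>\<^sup>+x. indicator ?U (x - T y) * indicator B x \<partial>lborel \<partial>lborel)"
  proof (rule nn_integral_cong)
    fix y
    show "(\<integral>\<^sup>+x. indicator ?U x * indicator B (T y + x) \<partial>lborel) =
        (\<integral>\<^sup>+x. indicator ?U (x - T y) * indicator B x \<partial>lborel)"
      using shift[of "\<lambda>x. indicator ?U (x - T y) * indicator B x" "T y"] by simp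
  qed
  also have "\<dots> = (\<integral>\<^sup>+x. \<integral>\<^sup>+y. indicator ?U (x - T y) * indicator B x \<partial>lborel \<partial>lborel)"
  proof (rule lborel_pair.Fubini')
    have "(\<lambda>(x, y). indicator ?U (x - T y) * indicator B x :: ennreal) \<in> borel_measurable (borel \<Otimes>\<^sub>M borel)"
      by measurable
    then show "(\<lambda>(x, y). indicator ?U (x - T y) * indicator B x :: ennreal) \<in> borel_measurable (lborel \<Otimes>\<^sub>M lborel)"
      by (simp cong: measurable_cong_sets sets_pair_measure_cong)
  qed
  also have "\<dots> = (\<integral>\<^sup>+x. emeasure lborel ?U * indicator B x \<partial>lborel)"
    by (simp add: nn_integral_multc 2)
  also have "\<dots> = emeasure lborel ?U * emeasure lborel B"
    by (simp add: nn_integral_cmult)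
  finally have "emeasure lborel ?U * emeasure (distr lborel borel T) B = emeasure lborel ?U * emeasure lborel B" .
  moreover have "emeasure lborel ?U < \<infinity>" by (rule emeasure_bounded_finite) simp
  moreover have "emeasure lborel ?U \<noteq> 0"
    by (simp add: emeasure_ball) (metis less_irrefl of_nat_0_le_iff unit_ball_vol_pos)
  ultimately show "emeasure (distr lborel borel T) B = emeasure lborel B"
    by (auto simp: ennreal_mult_cancel_left)
qed simp

text \<open>The normalised integrand is the product of standard normal densities in the coordinates
  with respect to \<open>Basis\<close>.\<close>

lemma gaussian_integral:
  "(LINT x|lborel. exp (- (norm (x :: 'a :: euclidean_space))\<^sup>2 / 2)) = sqrt (2 * pi) ^ DIM('a)"
proof -
  have one: "(\<integral>\<^sup>+x. ennreal (std_normal_density x) \<partial>lborel) = 1"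
    by (subst nn_integral_eq_integral) auto
  have "(\<integral>\<^sup>+x. (\<Prod>b\<in>Basis. ennreal (std_normal_density ((x :: 'a) \<bullet> b))) \<partial>lborel) = 1"
    by (subst nn_integral_lborel_prod[where f = "\<lambda>_ x. ennreal (std_normal_density x)"]) (simp_all add: one)
  also have "(\<lambda>x::'a. \<Prod>b\<in>Basis. ennreal (std_normal_density (x \<bullet> b))) =
      (\<lambda>x. ennreal (exp (- (norm x)\<^sup>2 / 2) / sqrt (2 * pi) ^ DIM('a)))"
  proof
    fix x :: 'a
    have "(\<Prod>b\<in>Basis. std_normal_density (x \<bullet> b)) =
        exp (\<Sum>b\<in>Basis. - (x \<bullet> b)\<^sup>2 / 2) / sqrt (2 * pi) ^ DIM('a)"
      by (simp add: std_normal_density_def prod.distrib exp_sum power_one_over prod_dividef)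
    also have "(\<Sum>b\<in>Basis. - (x \<bullet> b)\<^sup>2 / 2) = - (norm x)\<^sup>2 / 2"
      unfolding power2_norm_eq_inner
      by (subst euclidean_inner) (simp add: power2_eq_square sum_divide_distrib sum_negf)
    finally show "(\<Prod>b\<in>Basis. ennreal (std_normal_density (x \<bullet> b))) =
        ennreal (exp (- (norm x)\<^sup>2 / 2) / sqrt (2 * pi) ^ DIM('a))"
      by (simp add: prod_ennreal)
  qed
  finally have "has_bochner_integral lborel (\<lambda>x::'a. exp (- (norm x)\<^sup>2 / 2) / sqrt (2 * pi) ^ DIM('a)) 1"
    by (intro has_bochner_integral_nn_integral) auto
  then have "(LINT x|lborel. exp (- (norm (x :: 'a))\<^sup>2 / 2) / sqrt (2 * pi) ^ DIM('a)) = 1"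
    by (rule has_bochner_integral_integral_eq)
  then show ?thesis by (simp add: field_simps)
qed

lemma trace_conj_transpose:
  fixes Z :: "(complex, 'n :: finite) sqmat"
  shows "trace (Z ** conj_transpose Z) = of_real ((norm Z)\<^sup>2)"
  by (simp add: trace_def matrix_matrix_mult_def conj_transpose_def norm_vec_def L2_set_def
      sum_nonneg complex_norm_square flip: of_real_power)

lemma Z_avg_eq:
  fixes f :: "(complex, 'n :: finite) sqmat \<Rightarrow> complex"
  shows "Z_avg f = of_real (inverse ((2 * pi) ^ (CARD('n)\<^sup>2))) *
    (LINT Z|lborel. of_real (exp (- (norm Z)\<^sup>2 / 2)) * f Z)"
proof -
  have "exp (- (1/2) * trace (Z ** conj_transpose Z)) = of_real (exp (- (norm Z)\<^sup>2 / 2))"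
    for Z :: "(complex, 'n) sqmat"
    by (simp add: trace_conj_transpose exp_of_real[symmetric])
  then show ?thesis by (simp add: Z_avg_def)
qed

text \<open>The space has real dimension twice the number of entries, so the Gaussian integral is
  exactly the power of 2\<pi> in the normalisation.\<close>

lemma Z_avg_const: "Z_avg (\<lambda>Z :: (complex, 'n :: finite) sqmat. c) = c"
proof -
  have "DIM((complex, 'n) sqmat) = 2 * CARD('n)\<^sup>2" by (simp add: power2_eq_square)
  then have "(LINT Z :: (complex, 'n) sqmat|lborel. exp (- (norm Z)\<^sup>2 / 2)) = (2 * pi) ^ (CARD('n)\<^sup>2)"
    by (simp only: gaussian_integral) (simp add: power_mult)
  then have "(LINT Z :: (complex, 'n) sqmat|lborel. complex_of_real (exp (- (norm Z)\<^sup>2 / 2))) = of_real ((2 * pi) ^ (CARD('n)\<^sup>2))"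
    by (simp only: integral_complex_of_real)
  then show ?thesis by (simp add: Z_avg_eq field_simps)
qed

text \<open>Multiplication by \<open>u\<close> is a linear isometry and fixes the Gaussian factor,
  so the integral equals \<open>r\<close> times itself.\<close>

lemma Z_avg_eq_0:
  fixes f :: "(complex, 'n :: finite) sqmat \<Rightarrow> complex"
  assumes f [measurable]: "f \<in> borel_measurable borel" and u: "cmod u = 1"
    and hom: "\<And>Z. f (\<chi> i j. u * Z $ i $ j) = r * f Z" and "r \<noteq> 1"
  shows "Z_avg f = 0"
proof -
  define T :: "(complex, 'n) sqmat \<Rightarrow> (complex, 'n) sqmat" where "T Z = (\<chi> i j. u * Z $ i $ j)" for Z
  have lin: "linear T" by (rule linearI) (simp_all add: T_def vec_eq_iff algebra_simps)
  have norm: "norm (T Z) = norm Z" for Z by (simp add: T_def norm_vec_def L2_set_def norm_mult u)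
  have [measurable]: "T \<in> borel_measurable borel"
    using lin by (intro borel_measurable_continuous_onI linear_continuous_on) (simp add: linear_linear)
  let ?g = "\<lambda>Z :: (complex, 'n) sqmat. of_real (exp (- (norm Z)\<^sup>2 / 2)) * f Z"
  have "(LINT Z|lborel. ?g Z) = (LINT Z|distr lborel borel T. ?g Z)"
    by (simp add: lborel_distr_isometry[OF lin norm])
  also have "\<dots> = (LINT Z|lborel. ?g (T Z))"
    by (rule integral_distr) auto
  also have "(\<lambda>Z. ?g (T Z)) = (\<lambda>Z. r * ?g Z)"
    by (auto simp: norm hom T_def[symmetric] fun_eq_iff) (simp add: T_def hom)
  finally have "(LINT Z|lborel. ?g Z) = r * (LINT Z|lborel. ?g Z)" by simp
  with \<open>r \<noteq> 1\<close> have "(LINT Z|lborel. ?g Z) = 0" by simp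
  then show ?thesis by (simp add: Z_avg_eq)
qed

text \<open>The exponent with which a variable transforms under multiplication of Z by a
  phase.\<close>

primrec charge :: "('m, 'n) mat_var \<Rightarrow> int" where
  "charge (VH i j) = 0"
| "charge (VZ a b) = 1"
| "charge (VZbar a b) = - 1"

lemma mat_var_val_rotate:
  "mat_var_val H (\<chi> i j. cis \<theta> * Z $ i $ j) v = cis (\<theta> * charge v) * mat_var_val H Z v"
  by (cases v) (auto simp: cis_cnj)

lemma Z_avg_monomial_eq_0:
  fixes H :: "(complex, 'm :: finite) sqmat" and m :: "('m, 'n :: finite) mat_var multiset"
  assumes "(\<Sum>v\<in>#m. charge v) \<noteq> 0"
  shows "Z_avg (\<lambda>Z. \<Prod>v\<in>#m. mat_var_val H Z v) = 0"
proof -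
  \<comment> \<open>Chosen so that the rotation multiplies the monomial by
    \<open>cis pi = - 1\<close>.\<close>
  define \<theta> where "\<theta> = pi / (\<Sum>v\<in>#m. charge v)"
  have "(\<Prod>v\<in>#M. mat_var_val H (\<chi> i j. cis \<theta> * Z $ i $ j) v) =
      cis (\<theta> * (\<Sum>v\<in>#M. charge v)) * (\<Prod>v\<in>#M. mat_var_val H Z v)" for Z and M :: "('m, 'n) mat_var multiset"
    by (induction M) (auto simp: mat_var_val_rotate cis_mult[symmetric] distrib_left)
  note rot = this[where M = m]
  have cont: "continuous_on UNIV (\<lambda>Z :: (complex, 'n) sqmat. mat_var_val H Z v)" for v
    by (cases v) (auto intro!: continuous_intros)
  have "continuous_on UNIV (\<lambda>Z :: (complex, 'n) sqmat. \<Prod>v\<in>#M. mat_var_val H Z v)" for M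
    by (induction M) (auto intro!: continuous_intros cont)
  moreover have "\<theta> * (\<Sum>v\<in>#m. charge v) = pi"
    using assms by (simp add: \<theta>_def)
  ultimately show ?thesis
    by (intro Z_avg_eq_0[where u = "cis \<theta>" and r = "- 1"] borel_measurable_continuous_onI)
       (simp_all only: rot, simp_all)
qed

subsection \<open>Sums over multisets\<close>

lemma Sum_any_reindex:
  assumes "inj f" "\<And>x. x \<notin> range f \<Longrightarrow> g x = 0"
  shows "Sum_any g = Sum_any (\<lambda>y. g (f y))"
proof -
  have "{x. g x \<noteq> 0} = f ` {y. g (f y) \<noteq> 0}"
    using assms(2) by force
  then show ?thesis
    using assms(1) by (simp add: Sum_any.expand_set sum.reindex inj_on_subset[of f UNIV])
qed

lemma mSum_reindex_Suc:
  assumes "F 0 = 0"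
  shows "mSum F = mSum (\<lambda>i. F (Suc i))"
proof (rule mfps_eqI)
  fix m
  show "mcoeff (mSum F) m = mcoeff (mSum (\<lambda>i. F (Suc i))) m"
    unfolding mcoeff_mSum
  proof (rule Sum_any_reindex)
    fix k assume "k \<notin> range Suc"
    then show "mcoeff (F k) m = 0" using assms by (cases k) auto
  qed simp
qed

lemma finite_bounded_multisets:
  assumes "finite A"
  shows "finite {M. set_mset M \<subseteq> A \<and> size M \<le> n}"
proof -
  have "{M. set_mset M \<subseteq> A \<and> size M \<le> n} = (\<Union>k\<le>n. multisets_of_size A k)"
    by (auto simp: multisets_of_size_def)
  then show ?thesis using assms by auto
qed

text \<open>As \<open>i\<close> counts with the positive weight \<open>i + 1\<close>, the total
  bounds both the number of elements and each element. With weight \<open>i\<close> the multiset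
  could contain 0 arbitrarily often.\<close>

lemma finite_nat_multisets_weight: "finite {s. (\<Sum>i\<in>#s. int (Suc i)) \<le> K}"
proof (rule finite_subset)
  have "set_mset s \<subseteq> {..nat K} \<and> size s \<le> nat K" if "(\<Sum>i\<in>#s. int (Suc i)) \<le> K" for s
  proof -
    have "int (size s) \<le> (\<Sum>i\<in>#s. int (Suc i))" by (induction s) auto
    moreover have "int i \<le> (\<Sum>i\<in>#s. int (Suc i))" if "i \<in># s" for i
    proof -
      obtain r where r: "s = add_mset i r" using multi_member_split[OF \<open>i \<in># s\<close>] by blast
      have "0 \<le> (\<Sum>i\<in>#r. int (Suc i))" by (induction r) auto
      then show ?thesis by (simp add: r)
    qed
    then have "i \<le> nat K" if "i \<in># s" for i
      using that \<open>(\<Sum>i\<in>#s. int (Suc i)) \<le> K\<close> by (smt (verit) nat_le_iff zle_iff_zadd le_nat_iff)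
    ultimately show ?thesis using \<open>(\<Sum>i\<in>#s. int (Suc i)) \<le> K\<close> by auto
  qed
  then show "{s. (\<Sum>i\<in>#s. int (Suc i)) \<le> K} \<subseteq> {s. set_mset s \<subseteq> {..nat K} \<and> size s \<le> nat K}" by auto
qed (simp add: finite_bounded_multisets)

abbreviation lefts :: "('a + 'b) multiset \<Rightarrow> 'a multiset" where
  "lefts M \<equiv> (\<Sum>x\<in>#M. case_sum (\<lambda>x. {#x#}) (\<lambda>_. {#}) x)"

abbreviation rights :: "('a + 'b) multiset \<Rightarrow> 'b multiset" where
  "rights M \<equiv> (\<Sum>x\<in>#M. case_sum (\<lambda>_. {#}) (\<lambda>y. {#y#}) x)"

abbreviation mset_plus :: "'a multiset \<Rightarrow> 'b multiset \<Rightarrow> ('a + 'b) multiset" where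
  "mset_plus m s \<equiv> image_mset Inl m + image_mset Inr s"

lemma mset_plus_lefts_rights: "mset_plus (lefts M) (rights M) = M"
  by (induction M) (auto split: sum.split)

lemma lefts_mset_plus: "lefts (mset_plus m s) = m"
  and rights_mset_plus: "rights (mset_plus m s) = s"
proof -
  have l: "lefts (image_mset Inl m) = m" "rights (image_mset Inl m) = {#}"
    by (induction m) auto
  have r: "lefts (image_mset Inr s) = {#}" "rights (image_mset Inr s) = s"
    by (induction s) auto
  show "lefts (mset_plus m s) = m" "rights (mset_plus m s) = s"
    by (simp_all only: image_mset_union sum_mset.union l r add_0_right add_0_left)
qed

lemma sum_mset_plus:
  "(\<Sum>x\<in>#mset_plus m s. case_sum f g x) = (\<Sum>x\<in>#m. f x) + (\<Sum>y\<in>#s. g y :: 'c :: comm_monoid_add)"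
  by (simp add: multiset.map_comp o_def)

lemma prod_mset_plus:
  "(\<Prod>x\<in>#mset_plus m s. case_sum f g x) = (\<Prod>x\<in>#m. f x) * (\<Prod>y\<in>#s. g y :: 'c :: comm_monoid_mult)"
  by (simp add: multiset.map_comp o_def)

subsection \<open>The formal variables of the open partition function\<close>

primrec zbar_deg :: "('m, 'n) mat_var \<Rightarrow> int" where
  "zbar_deg (VH i j) = 0"
| "zbar_deg (VZ a b) = 0"
| "zbar_deg (VZbar a b) = 1"

text \<open>In the integrand \<open>s i\<close> always comes with \<open>i + 1\<close> variables \<open>VZbar\<close>.\<close>

definition zs_wt :: "('m, 'n) mat_var + nat \<Rightarrow> int" where
  "zs_wt = case_sum zbar_deg (\<lambda>i. - int (Suc i))"

lemma sum_zs_wt: "(\<Sum>x\<in>#mset_plus m s. zs_wt x) = (\<Sum>x\<in>#m. zbar_deg x) - (\<Sum>i\<in>#s. int (Suc i))"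
proof -
  have "(\<Sum>i\<in>#s. - int (Suc i)) = - (\<Sum>i\<in>#s. int (Suc i))" by (induction s) auto
  then show ?thesis unfolding zs_wt_def sum_mset_plus by simp
qed

text \<open>The number of Z equals the charge plus the number of Zbar. For neutral monomials the
  degrees in H and Zbar therefore determine the size.\<close>

lemma size_mat_var_multiset:
  "int (size m) = int (size (filter_mset is_VH m)) + (\<Sum>v\<in>#m. charge v) + 2 * (\<Sum>v\<in>#m. zbar_deg v)"
proof (induction m)
  case (add v m)
  then show ?case by (cases v) auto
qed simp

lemma finite_mat_var: "finite (UNIV :: ('m :: finite, 'n :: finite) mat_var set)"
proof -
  have "(UNIV :: ('m, 'n) mat_var set) \<subseteq> range (case_prod VH) \<union> range (case_prod VZ) \<union> range (case_prod VZbar)"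
  proof
    fix v :: "('m, 'n) mat_var"
    show "v \<in> range (case_prod VH) \<union> range (case_prod VZ) \<union> range (case_prod VZbar)"
      by (cases v) (auto simp: image_iff)
  qed
  then show ?thesis by (rule finite_subset) simp
qed

lemma finite_mat_var_multisets: "finite {m :: ('m :: finite, 'n :: finite) mat_var multiset. size m \<le> n}"
  using finite_bounded_multisets[OF finite_mat_var, of n] by simp

locale s_subst =
  fixes v :: "nat \<Rightarrow> complex fls"
begin

text \<open>Matrix variables are kept, and \<open>s i\<close> becomes the scalar \<open>v i\<close>.
  Over a fixed \<open>m\<close> a nonnegative weight bounds the sum of the \<open>i + 1\<close> by
  the Zbar degree of \<open>m\<close>, so the fibres are finite whatever the values
  \<open>v i\<close> are.\<close>

sublocale mfps_subst "zs_wt :: ('m, 'n) mat_var + nat \<Rightarrow> int" "case_sum (\<lambda>x. {#x#}) (\<lambda>_. {#})"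
    "case_sum (\<lambda>_. 1) v"
proof
  fix m :: "('m, 'n) mat_var multiset"
  let ?S = "{s. (\<Sum>i\<in>#s. int (Suc i)) \<le> (\<Sum>x\<in>#m. zbar_deg x)}"
  have "M \<in> mset_plus m ` ?S" if M: "0 \<le> (\<Sum>x\<in>#M. zs_wt x)" "lefts M = m" for M
  proof (rule image_eqI)
    show "M = mset_plus m (rights M)" using mset_plus_lefts_rights[of M] M(2) by simp
    with M(1) sum_zs_wt[of m "rights M"] show "rights M \<in> ?S" by simp
  qed
  then have "{M. 0 \<le> (\<Sum>x\<in>#M. zs_wt x) \<and> (\<Prod>x\<in>#M. case_sum (\<lambda>_. 1) v x) \<noteq> 0 \<and> lefts M = m} \<subseteq> mset_plus m ` ?S"
    by blast
  then show "finite {M. 0 \<le> (\<Sum>x\<in>#M. zs_wt x) \<and> (\<Prod>x\<in>#M. case_sum (\<lambda>_. 1) v x) \<noteq> 0 \<and> lefts M = m}"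
    by (rule finite_subset) (intro finite_imageI finite_nat_multisets_weight)
qed

text \<open>The set \<open>T\<close> only has to contain every contributing \<open>s\<close>: in
  this form the sum can be compared with a \<open>Sum_any\<close> over \<open>s\<close>, also after
  passing to single coefficients in \<open>X\<close>.\<close>

lemma mcoeff_subst_sum:
  fixes F :: "(('m, 'n) mat_var + nat, complex fls) mfps"
  assumes F: "order_ge 0 zs_wt 0 F"
  obtains T where "finite T" "\<And>s. mcoeff F (mset_plus m s) * (\<Prod>i\<in>#s. v i) \<noteq> 0 \<Longrightarrow> s \<in> T"
    "mcoeff (subst F) m = (\<Sum>s\<in>T. mcoeff F (mset_plus m s) * (\<Prod>i\<in>#s. v i))"
proof -
  define T where "T = {s. mset_plus m s \<in> preimage m}"
  have T: "bij_betw (mset_plus m) T (preimage m)"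
  proof (rule bij_betw_byWitness[where f' = rights])
    have "mset_plus m (rights M) = M" if "M \<in> preimage m" for M
      using that mset_plus_lefts_rights[of M] by (simp add: preimage_def)
    then show "\<forall>M\<in>preimage m. mset_plus m (rights M) = M" "rights ` preimage m \<subseteq> T"
      by (auto simp: T_def)
    show "\<forall>s\<in>T. rights (mset_plus m s) = s" by (simp only: rights_mset_plus) simp
  qed (auto simp: T_def)
  show thesis
  proof
    show "finite T" using T finite_preimage bij_betw_finite by blast
    show "mcoeff (subst F) m = (\<Sum>s\<in>T. mcoeff F (mset_plus m s) * (\<Prod>i\<in>#s. v i))"
      unfolding mcoeff_subst sum.reindex_bij_betw[OF T, symmetric] prod_mset_plus by simp
  next
    fix s assume nz: "mcoeff F (mset_plus m s) * (\<Prod>i\<in>#s. v i) \<noteq> 0"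
    then have "0 \<le> (\<Sum>x\<in>#mset_plus m s. zs_wt x)" using order_geD[OF F, of "mset_plus m s"] by simp
    moreover have "(\<Prod>x\<in>#mset_plus m s. case_sum (\<lambda>_. 1) v x) \<noteq> 0" using nz by (simp only: prod_mset_plus) simp
    ultimately show "s \<in> T"
      unfolding T_def preimage_def by (simp only: mem_Collect_eq lefts_mset_plus simp_thms)
  qed
qed

end

section \<open>Orders of the factors of the integrand that do not involve Zbar\<close>

lemma order_ge_mono: "order_ge e w k f \<Longrightarrow> j \<le> k \<Longrightarrow> order_ge e w j f"
  unfolding order_ge_def by (meson order.trans)

text \<open>Discharges the support conditions of a substitution whose weight is identically
  0.\<close>

lemma order_ge_trivial: "order_ge 0 (\<lambda>_. 0) 0 f"
  by (rule order_geI) simp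

lemma order_ge_var_mat: "(\<And>i j. k \<le> w (x i j)) \<Longrightarrow> order_ge e w k (var_mat x $ i $ j :: ('v, 'a :: idom fls) mfps)"
  by (simp add: var_mat_def order_ge_mvar)

lemma order_ge_trace_var_mat_pow:
  fixes x :: "'n :: finite \<Rightarrow> 'n \<Rightarrow> 'v"
  assumes "\<And>i j. k \<le> w (x i j)"
  shows "order_ge e w (int r * k) (trace (mat_pow (var_mat x) r) :: ('v, 'a :: idom fls) mfps)"
  by (intro order_ge_trace order_ge_mat_pow order_ge_var_mat assms)

definition cubic :: "('n :: finite \<Rightarrow> 'n \<Rightarrow> 'v) \<Rightarrow> ('v, complex fls) mfps" where
  "cubic x = mconst (1/6) * trace (mat_pow (var_mat x) 3)"

lemma order_ge_cubic:
  assumes "\<And>i j. w (x i j) = k"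
  shows "order_ge e w (3 * k) (cubic x)"
proof -
  have "coeff_ge e 0 (inverse (of_nat 6) :: complex fls)"
    by (simp add: coeff_ge_def fls_inverse_subdegree del: of_nat_numeral)
  then have "coeff_ge e 0 (1/6 :: complex fls)" by (simp add: inverse_eq_divide)
  then have "order_ge e w (0 + int 3 * k) (cubic x)"
    unfolding cubic_def using assms
    by (intro order_ge_mult order_ge_trace_var_mat_pow order_ge_mconst) auto
  then show ?thesis by simp
qed

lemma order_ge_cubic_size: "order_ge 0 (\<lambda>_. 1) 1 (cubic x)"
  by (rule order_ge_mono[OF order_ge_cubic[where k = 1]]) auto

lemma coeff_ge_lam: "coeff_ge e (- int e) (lam l i)"
  by (auto simp: coeff_ge_def lam_def)

lemma order_ge_Lam: "order_ge e w (- int e) (Lam l $ i $ j)"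
  by (auto simp: Lam_def diag_mat_def intro: order_ge_mconst coeff_ge_lam)

lemma order_ge_det_Lam: "order_ge e w (- int (e * CARD('m))) (det (Lam l))"
  for l :: "(real, 'm :: finite) vec"
  using order_ge_det[OF order_ge_Lam, of e w l] by (simp add: algebra_simps)

lemma order_ge_kron_1:
  fixes A :: "(('v, 'a :: idom fls) mfps, 'k :: finite) sqmat"
  assumes "\<And>i j. order_ge e w k (A $ i $ j)"
  shows "order_ge e w k (kron A (mat 1) $ p $ q)"
    and "order_ge e w k (kron (mat 1) A $ p' $ q')"
  using order_ge_mult[OF assms order_ge_1] order_ge_mult[OF order_ge_1 assms]
  by (auto simp: kron_def mat_def)

lemma order_ge_diff_component:
  fixes A B :: "(('v, 'a :: idom fls) mfps, 'k :: finite) sqmat"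
  assumes "order_ge e w k (A $ i $ j)" "order_ge e w k (B $ i $ j)"
  shows "order_ge e w k ((A - B) $ i $ j)"
  using order_ge_diff[OF assms] by simp

text \<open>The denominator after the shift of H by \<Lambda>, that is (\<Lambda> - H) \<otimes> 1 -
  1 \<otimes> Z under the determinant.\<close>

definition HZ_det :: "(real, 'm :: finite) vec \<Rightarrow> (('m, 'n :: finite) mat_var + nat, complex fls) mfps" where
  "HZ_det l = det (kron (- (var_mat (\<lambda>i j. Inl (VH i j)) - Lam l)) (mat 1 :: (_, 'n) sqmat)
     - kron (mat 1) (var_mat (\<lambda>a b. Inl (VZ a b))))"

lemma order_ge_HZ_det:
  fixes l :: "(real, 'm :: finite) vec" and w :: "('m, 'n :: finite) mat_var + nat \<Rightarrow> int"
  assumes w: "\<And>i j. w (Inl (VH i j)) = 0" "\<And>a b. w (Inl (VZ a b)) = 0"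
  shows "order_ge e w (- int (e * CARD('m) * CARD('n))) (HZ_det l)"
proof -
  have H: "order_ge e w (- int e) ((- (var_mat (\<lambda>i j. Inl (VH i j)) - Lam l)) $ i $ j)" for i j
    unfolding vector_minus_component vector_uminus_component using w
    by (intro order_ge_uminus order_ge_diff order_ge_Lam order_ge_var_mat) auto
  have Z: "order_ge e w (- int e) (var_mat (\<lambda>a b. Inl (VZ a b)) $ i $ j :: (('m, 'n) mat_var + nat, complex fls) mfps)" for i j
    using w by (intro order_ge_var_mat) auto
  have "order_ge e w (int CARD('m \<times> 'n) * - int e) (HZ_det l)"
    unfolding HZ_det_def
    by (rule order_ge_det[OF order_ge_diff_component[OF order_ge_kron_1(1)[OF H] order_ge_kron_1(2)[OF Z]]])
  then show ?thesis by (simp add: algebra_simps)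
qed

lemma mcoeff_mvar_empty: "mcoeff (mvar v) {#} = 0"
  by (simp add: mcoeff_mvar)

lemma mcoeff_Lam_empty: "mcoeff (Lam l $ i $ j) {#} = diag_mat (\<chi> i. lam l i) $ i $ j"
  by (simp add: Lam_def diag_mat_def mcoeff_mconst)

lemma det_diag_mat: "det (diag_mat v) = (\<Prod>i\<in>UNIV. v $ i)" for v :: "('a :: comm_ring_1, 'n :: finite) vec"
  by (subst det_diagonal) (auto simp: diag_mat_def)

lemma mcoeff_det_minus_var_mat:
  fixes l :: "(real, 'm :: finite) vec"
  shows "mcoeff (det (- (var_mat x - Lam l))) {#} = (\<Prod>i\<in>UNIV. lam l i)"
proof -
  have "(\<chi> i j. mcoeff ((- (var_mat x - Lam l)) $ i $ j) {#}) = diag_mat (\<chi> i. lam l i)"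
    by (simp add: vec_eq_iff mcoeff_Lam_empty) (simp add: var_mat_def mcoeff_mvar_empty)
  then show ?thesis by (simp add: mcoeff_empty.hom_det det_diag_mat)
qed

lemma mcoeff_HZ_det:
  fixes l :: "(real, 'm :: finite) vec"
  shows "mcoeff (HZ_det l :: (('m, 'n :: finite) mat_var + nat, complex fls) mfps) {#} = (\<Prod>i\<in>UNIV. lam l i) ^ CARD('n)"
proof -
  have "(\<chi> p q. mcoeff ((kron (- (var_mat (\<lambda>i j. Inl (VH i j)) - Lam l)) (mat 1 :: (_, 'n) sqmat)
     - kron (mat 1) (var_mat (\<lambda>a b. Inl (VZ a b))) :: ((('m, 'n) mat_var + nat, complex fls) mfps, 'm \<times> 'n) sqmat) $ p $ q) {#}) =
     kron (diag_mat (\<chi> i. lam l i)) (mat 1 :: (_, 'n) sqmat)"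
    by (simp add: vec_eq_iff kron_def mcoeff_mult_empty mcoeff_Lam_empty)
       (simp add: var_mat_def mcoeff_mvar_empty mat_def mcoeff_1)
  then show ?thesis
    unfolding HZ_det_def mcoeff_empty.hom_det by (simp only: det_kron_mat_1 det_diag_mat) simp
qed

lemma lam_nonzero: "l $ i > 0 \<Longrightarrow> lam l i \<noteq> 0"
  by (simp add: lam_def)

text \<open>The constant coefficient is the N-th power of the product of the \<lambda> and has order
  - M N, the lowest order that the determinant admits; this is what \<open>order_ge_inverse\<close>
  asks for.\<close>

lemma order_ge_inverse_HZ_det:
  fixes l :: "(real, 'm :: finite) vec" and w :: "('m, 'n :: finite) mat_var + nat \<Rightarrow> int"
  assumes l: "\<And>i. l $ i > 0"
    and w: "\<And>i j. w (Inl (VH i j)) = 0" "\<And>a b. w (Inl (VZ a b)) = 0"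
  shows "order_ge e w (int (e * CARD('m) * CARD('n))) (inverse (HZ_det l))"
proof -
  have "fls_subdegree (\<Prod>i\<in>UNIV. lam l i) = (\<Sum>i\<in>UNIV. fls_subdegree (lam l i))"
    using l by (intro fls_subdegree_prod) (auto simp: lam_nonzero)
  also have "\<dots> = - int CARD('m)"
  proof -
    have "fls_subdegree (lam l i) = - 1" for i
      using l[of i] by (simp add: lam_def)
    then show ?thesis by simp
  qed
  finally have "coeff_ge e (int (e * CARD('m) * CARD('n))) (inverse ((\<Prod>i\<in>UNIV. lam l i) ^ CARD('n)))"
    by (simp add: coeff_ge_def fls_inverse_subdegree fls_subdegree_pow)
  with order_ge_inverse[OF order_ge_HZ_det[of w e l]] w show ?thesis
    by (simp add: mcoeff_HZ_det)
qed

definition reduced_integrand ::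
    "(real, 'm :: finite) vec \<Rightarrow> (('m, 'n :: finite) mat_var + nat, complex fls) mfps" where
  "reduced_integrand l = mexp (cubic (\<lambda>i j. Inl (VH i j))) *
     (mexp (cubic (\<lambda>a b :: 'n. Inl (VZ a b))) * (det (Lam l) ^ CARD('n) * inverse (HZ_det l)))"

text \<open>The orders of the numerator and of the inverse determinant cancel exactly. The weights
  of Zbar and of the s variables stay arbitrary because these do not occur; suitable choices of
  \<open>w\<close> later turn this one bound into statements about their absence.\<close>

lemma order_ge_reduced_integrand:
  fixes l :: "(real, 'm :: finite) vec" and w :: "('m, 'n :: finite) mat_var + nat \<Rightarrow> int"
  assumes l: "\<And>i. l $ i > 0"
    and w: "\<And>i j. w (Inl (VH i j)) = 0" "\<And>a b. w (Inl (VZ a b)) = 0"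
  shows "order_ge e w 0 (reduced_integrand l)"
proof -
  have "order_ge e w (int CARD('n) * - int (e * CARD('m)) + int (e * CARD('m) * CARD('n)))
      (det (Lam l) ^ CARD('n) * inverse (HZ_det l :: (('m, 'n) mat_var + nat, complex fls) mfps))"
    by (intro order_ge_mult order_ge_power order_ge_det_Lam order_ge_inverse_HZ_det l w)
  then have "order_ge e w 0 (det (Lam l) ^ CARD('n) * inverse (HZ_det l :: (('m, 'n) mat_var + nat, complex fls) mfps))"
    by (simp add: algebra_simps)
  moreover have "order_ge e w 0 (cubic (\<lambda>i j. Inl (VH i j)))"
    using order_ge_cubic[of w "\<lambda>i j. Inl (VH i j)" 0 e] w by simp
  moreover have "order_ge e w 0 (cubic (\<lambda>a b. Inl (VZ a b)))"
    using order_ge_cubic[of w "\<lambda>a b. Inl (VZ a b)" 0 e] w by simp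
  ultimately show ?thesis
    unfolding reduced_integrand_def
    by (intro order_ge_mult_0[OF order_ge_mexp order_ge_mult_0[OF order_ge_mexp]])
qed

subsection \<open>Restriction to the Hermitian variables\<close>

definition emb_H :: "'m \<times> 'm \<Rightarrow> ('m, 'n) mat_var + nat" where
  "emb_H p = Inl (VH (fst p) (snd p))"

text \<open>With \<open>H_fac\<close> this describes the evaluation at Z = Zbar = s = 0, the
  variables of H being renamed to the index pairs over which \<open>H_integral\<close>
  works.\<close>

definition H_mon :: "('m, 'n) mat_var + nat \<Rightarrow> ('m \<times> 'm) multiset" where
  "H_mon x = (case x of Inl (VH i j) \<Rightarrow> {#(i, j)#} | _ \<Rightarrow> {#})"

definition H_fac :: "('m, 'n) mat_var + nat \<Rightarrow> complex fls" where
  "H_fac x = (case x of Inl (VH i j) \<Rightarrow> 1 | _ \<Rightarrow> 0)"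

lemma H_fac_nonzero:
  assumes "(\<Prod>x\<in>#M. H_fac x) \<noteq> 0"
  shows "M = image_mset emb_H (\<Sum>x\<in>#M. H_mon x)"
  using assms
proof (induction M)
  case (add x M)
  then have "H_fac x \<noteq> 0" by auto
  then obtain i j where "x = Inl (VH i j)"
    by (auto simp: H_fac_def split: sum.splits mat_var.splits)
  with add show ?case by (simp add: emb_H_def H_mon_def)
qed simp

lemma H_preimage:
  "{M :: (('m, 'n) mat_var + nat) multiset. 0 \<le> (\<Sum>x\<in>#M. 0 :: int) \<and> (\<Prod>x\<in>#M. H_fac x) \<noteq> 0 \<and> (\<Sum>x\<in>#M. H_mon x) = m} = {image_mset emb_H m}"
proof -
  let ?e = "image_mset emb_H m :: (('m, 'n) mat_var + nat) multiset"
  have 1: "(\<Prod>x\<in>#?e. H_fac x) = 1" and 2: "(\<Sum>x\<in>#?e. H_mon x) = m"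
    by (induction m) (auto simp: H_fac_def H_mon_def emb_H_def)
  have "(0 :: int) \<le> (\<Sum>x\<in>#?e. 0)" "(\<Prod>x\<in>#?e. H_fac x) \<noteq> 0"
    by (simp only: sum_mset.neutral_const) (simp only: 1 one_neq_zero not_False_eq_True)
  moreover have "M = ?e" if "(\<Prod>x\<in>#M. H_fac x) \<noteq> 0" "(\<Sum>x\<in>#M. H_mon x) = m"
    for M :: "(('m, 'n) mat_var + nat) multiset"
    using H_fac_nonzero[OF that(1)] unfolding that(2) .
  ultimately show ?thesis using 2 by blast
qed

interpretation H_subst: mfps_subst "\<lambda>_. 0" H_mon H_fac
  by standard (unfold H_preimage, simp)

lemma mcoeff_H_subst: "mcoeff (H_subst.subst f) m = mcoeff f (image_mset emb_H m)"
  for f :: "(('m, 'n) mat_var + nat, complex fls) mfps"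
proof -
  have "(\<Prod>x\<in>#(image_mset emb_H m :: (('m, 'n) mat_var + nat) multiset). H_fac x) = 1"
    by (induction m) (auto simp: H_fac_def emb_H_def)
  then show ?thesis
    unfolding H_subst.mcoeff_subst H_subst.preimage_def H_preimage by simp
qed

text \<open>For the zero weight \<open>subst_mult\<close> holds for all series, so here the
  substitution is a ring homomorphism on the whole ring.\<close>

interpretation H_subst: comm_ring_1_hom H_subst.subst
  by standard (auto simp: H_subst.subst_1 H_subst.subst_add intro: H_subst.subst_mult order_ge_trivial)

lemma H_subst_mvar:
  "H_subst.subst (mvar (Inl (VH i j) :: ('m, 'n) mat_var + nat)) = mvar (i, j)"
  "H_subst.subst (mvar (Inl (VZ a b) :: ('m, 'n) mat_var + nat)) = 0"
proof -
  have "image_mset emb_H m = {#x#} \<longleftrightarrow> (\<exists>p. m = {#p#} \<and> x = emb_H p)"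
    for m and x :: "('m, 'n) mat_var + nat"
    by (auto dest: msed_map_invR simp: single_is_union)
  then show "H_subst.subst (mvar (Inl (VH i j) :: ('m, 'n) mat_var + nat)) = mvar (i, j)"
    "H_subst.subst (mvar (Inl (VZ a b) :: ('m, 'n) mat_var + nat)) = 0"
    by (auto intro!: mfps_eqI simp: mcoeff_H_subst mcoeff_mvar emb_H_def)
qed

lemma H_subst_mexp_cubic:
  "H_subst.subst (mexp (cubic x)) = mexp (mconst (1/6) * trace (mat_pow (\<chi> i j. H_subst.subst (mvar (x i j))) 3))"
proof -
  have "H_subst.subst (cubic x) = mconst (1/6) * trace (mat_pow (\<chi> i j. H_subst.subst (mvar (x i j))) 3)"
    by (simp add: cubic_def H_subst.subst_mconst_mult H_subst.hom_trace_mat_pow) (simp add: var_mat_def)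
  then show ?thesis by (simp add: H_subst.subst_mexp order_ge_trivial order_ge_cubic_size)
qed

lemma H_subst_Lam: "H_subst.subst (Lam l $ i $ j) = Lam l $ i $ j"
  by (simp add: Lam_def diag_mat_def H_subst.subst_mconst H_subst.subst_0)

text \<open>At Z = 0 only (\<Lambda> - H) \<otimes> 1 is left, and \<open>det_kron_mat_1\<close>
  produces the exponent N of the Kontsevich-Penner model.\<close>

lemma H_subst_HZ_det:
  fixes l :: "(real, 'm :: finite) vec"
  shows "H_subst.subst (HZ_det l :: (('m, 'n :: finite) mat_var + nat, complex fls) mfps) =
    det (- (var_mat Pair - Lam l)) ^ CARD('n)"
proof -
  have H: "H_subst.subst ((- (var_mat (\<lambda>i j. Inl (VH i j)) - Lam l)) $ i $ j :: (('m, 'n) mat_var + nat, complex fls) mfps) =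
      (- (var_mat Pair - Lam l)) $ i $ j" for i j
    by (simp only: vector_minus_component vector_uminus_component H_subst.hom_uminus H_subst.hom_diff H_subst_Lam)
       (simp add: var_mat_def H_subst_mvar)
  have Z: "H_subst.subst (var_mat (\<lambda>a b. Inl (VZ a b)) $ i $ j :: (('m, 'n) mat_var + nat, complex fls) mfps) = 0" for i j :: 'n
    by (simp add: var_mat_def H_subst_mvar)
  have one: "H_subst.subst (mat 1 $ i $ j) = mat 1 $ i $ j" for i j :: "'k :: finite"
    by (simp add: mat_def H_subst.hom_1 H_subst.hom_0)
  have "(\<chi> p q. H_subst.subst ((kron (- (var_mat (\<lambda>i j. Inl (VH i j)) - Lam l)) (mat 1 :: (_, 'n) sqmat)
     - kron (mat 1) (var_mat (\<lambda>a b. Inl (VZ a b))) :: (_, 'm \<times> 'n) sqmat) $ p $ q)) =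
     kron (- (var_mat Pair - Lam l)) (mat 1 :: (_, 'n) sqmat)"
    by (simp only: vec_eq_iff kron_def vec_lambda_beta vector_minus_component H_subst.hom_diff
        H_subst.hom_mult H Z one mult_zero_right diff_zero) simp
  then show ?thesis
    unfolding HZ_det_def H_subst.hom_det by (simp only: det_kron_mat_1)
qed

lemma H_subst_reduced_integrand:
  fixes l :: "(real, 'm :: {finite, linorder}) vec"
  assumes l: "\<And>i. l $ i > 0"
  shows "H_subst.subst (reduced_integrand l :: (('m, 'n :: finite) mat_var + nat, complex fls) mfps) =
    shifted_integrand l Pair (\<lambda>H. det (Lam l) ^ CARD('n) / det (- H) ^ CARD('n))"
proof -
  have lam: "(\<Prod>i\<in>UNIV. lam l i) \<noteq> 0" using l by (simp add: lam_nonzero)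
  have "H_subst.subst (inverse (HZ_det l :: (('m, 'n) mat_var + nat, complex fls) mfps)) =
      inverse (det (- (var_mat Pair - Lam l)) ^ CARD('n))"
    unfolding H_subst_HZ_det[symmetric]
    by (rule H_subst.subst_inverse)
       (simp_all add: order_ge_trivial mcoeff_HZ_det lam H_subst_HZ_det mcoeff_empty.hom_power
          mcoeff_det_minus_var_mat del: minus_diff_eq)
  moreover have "H_subst.subst (mexp (cubic (\<lambda>a b. Inl (VZ a b :: ('m, 'n) mat_var)))) = 1"
  proof -
    have "trace (mat_pow (0 :: (('m \<times> 'm, complex fls) mfps, 'n) sqmat) 3) = 0"
      by (simp add: numeral_3_eq_3 trace_def)
    moreover have "(\<chi> a b. H_subst.subst (mvar (Inl (VZ a b :: ('m, 'n) mat_var)))) = 0"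
      by (simp add: vec_eq_iff H_subst_mvar)
    ultimately show ?thesis unfolding H_subst_mexp_cubic by (simp add: mexp_0)
  qed
  moreover have "H_subst.subst (mexp (cubic (\<lambda>i j. Inl (VH i j :: ('m, 'n) mat_var)))) = mexp (mconst (1/6) * trace (mat_pow (var_mat Pair) 3))"
    unfolding H_subst_mexp_cubic by (simp add: H_subst_mvar var_mat_def)
  moreover have "H_subst.subst (det (Lam l) :: (('m, 'n) mat_var + nat, complex fls) mfps) = det (Lam l)"
    by (simp add: H_subst.hom_det H_subst_Lam)
  ultimately show ?thesis
    by (simp add: reduced_integrand_def shifted_integrand_def divide_mfps_def H_subst.hom_mult H_subst.hom_power
        del: minus_diff_eq)
qed

subsection \<open>Cancellation of the exponentials\<close>

definition Zbar_trace :: "nat \<Rightarrow> (('m, 'n :: finite) mat_var + nat, complex fls) mfps" where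
  "Zbar_trace k = trace (mat_pow (transpose (var_mat (\<lambda>a b. Inl (VZbar a b)))) k)"

lemma order_ge_Zbar_trace:
  assumes "\<And>a b. w (Inl (VZbar a b)) = k"
  shows "order_ge e w (int r * k) (Zbar_trace r :: (('m, 'n :: finite) mat_var + nat, complex fls) mfps)"
proof -
  have "transpose (var_mat (\<lambda>a b. Inl (VZbar a b))) =
      (var_mat (\<lambda>a b. Inl (VZbar b a)) :: ((('m, 'n) mat_var + nat, complex fls) mfps, 'n) sqmat)"
    by (simp add: transpose_def var_mat_def)
  with assms show ?thesis
    unfolding Zbar_trace_def by (simp only:) (intro order_ge_trace_var_mat_pow, simp)
qed

section \<open>Values of the s variables and the two exponents\<close>

lemma tr_Lam_powi_eq:
  "tr_Lam_powi l (- int k) = fls_const (\<Sum>i\<in>UNIV. inverse (of_real (l $ i) ^ k)) * fls_X ^ k"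
proof -
  have "lam l i powi (- int k) = fls_const (inverse (of_real (l $ i) ^ k)) * fls_X ^ k" for i
    by (simp add: lam_def power_int_minus power_mult_distrib fls_inverse_const
        fls_inverse_X_inv_power flip: fls_const_power)
  moreover have "fls_const (\<Sum>i\<in>I. f i) = (\<Sum>i\<in>I. fls_const (f i))" for f :: "'a \<Rightarrow> complex" and I
    by (induction I rule: infinite_finite_induct) (simp_all flip: fls_plus_const)
  ultimately show ?thesis
    by (simp add: tr_Lam_powi_def trace_def diag_mat_def sum_distrib_right)
qed

lemma coeff_ge_const_X_power: "coeff_ge e (int e * int k) (fls_const c * fls_X ^ k :: complex fls)"
  by (auto simp: coeff_ge_def)

lemma coeff_ge_tr_Lam_powi: "coeff_ge e (int e * int k) (tr_Lam_powi l (- int k))"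
  unfolding tr_Lam_powi_eq by (rule coeff_ge_const_X_power)

definition s_val :: "(real, 'm :: finite) vec \<Rightarrow> nat \<Rightarrow> complex fls" where
  "s_val l i = 2 ^ i * of_nat (fact i) * tr_Lam_powi l (- 2 * int i - 2)"

lemma s_val_eq: "\<exists>c. s_val l i = fls_const c * fls_X ^ (2 * Suc i)"
proof -
  have "- 2 * int i - 2 = - int (2 * Suc i)" by simp
  moreover have "2 ^ i * of_nat (fact i) = (fls_const (of_nat (2 ^ i * fact i)) :: complex fls)"
    by (subst fls_of_nat[symmetric]) simp
  ultimately have "s_val l i = fls_const (of_nat (2 ^ i * fact i) *
      (\<Sum>j\<in>UNIV. inverse (of_real (l $ j) ^ (2 * Suc i)))) * fls_X ^ (2 * Suc i)"
    unfolding s_val_def by (simp only: tr_Lam_powi_eq fls_const_mult_const[symmetric] mult.assoc)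
  then show ?thesis ..
qed

text \<open>By homogeneity, multiplication by such a product merely shifts the powers of
  \<open>X\<close> and rescales. The scalar never matters and stays existential.\<close>

lemma prod_s_val: "\<exists>c. (\<Prod>i\<in>#s. s_val l i) = fls_const c * fls_X ^ (2 * (\<Sum>i\<in>#s. Suc i))"
proof (induction s)
  case empty
  show ?case by (rule exI[of _ 1]) simp
next
  case (add i s)
  obtain c d where "(\<Prod>i\<in>#s. s_val l i) = fls_const c * fls_X ^ (2 * (\<Sum>i\<in>#s. Suc i))"
    "s_val l i = fls_const d * fls_X ^ (2 * Suc i)"
    using add s_val_eq by blast
  then have "(\<Prod>i\<in>#add_mset i s. s_val l i) =
      (fls_const d * fls_const c) * (fls_X ^ (2 * Suc i) * fls_X ^ (2 * (\<Sum>i\<in>#s. Suc i)))"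
    by (simp add: mult_ac)
  also have "\<dots> = fls_const (d * c) * fls_X ^ (2 * (\<Sum>i\<in>#add_mset i s. Suc i))"
    by (simp only: fls_const_mult_const power_add[symmetric]) (simp add: algebra_simps)
  finally show ?case by blast
qed

text \<open>The index \<open>i\<close> stands for \<open>k = i + 1\<close>, which aligns the terms
  with those of \<open>s_exponent\<close>.\<close>

definition sqrt_exponent :: "(real, 'm :: finite) vec \<Rightarrow> (('m, 'n :: finite) mat_var + nat, complex fls) mfps" where
  "sqrt_exponent l = mSum (\<lambda>i. mconst (- 1/2 * (1 / of_nat (Suc i) * tr_Lam_powi l (- int (2 * Suc i)))) *
     Zbar_trace (Suc i))"

definition s_exponent :: "(('m, 'n :: finite) mat_var + nat, complex fls) mfps" where
  "s_exponent = mSum (\<lambda>i. mconst (inverse (2 ^ (i + 1)) / of_nat (fact (i + 1))) *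
     mvar (Inr i) * Zbar_trace (Suc i))"

lemma coeff_ge_rational:
  "coeff_ge e 0 (- 1/2 * (1 / of_nat (Suc i)) :: complex fls)"
  "coeff_ge e 0 (inverse (2 ^ (i + 1)) / of_nat (fact (i + 1)) :: complex fls)"
proof -
  have 2: "coeff_ge e 0 (inverse 2 :: complex fls)"
    using coeff_ge_of_nat_inverse[of e 2] by simp
  have "coeff_ge e (0 + 0) (- inverse 2 * inverse (of_nat (Suc i)) :: complex fls)"
    by (intro coeff_ge_mult coeff_ge_of_nat_inverse) (use 2 in \<open>simp add: inverse_eq_divide\<close>)
  then show "coeff_ge e 0 (- 1/2 * (1 / of_nat (Suc i)) :: complex fls)"
    by (simp add: inverse_eq_divide)
  have "coeff_ge e (0 + 0) (inverse (of_nat (2 ^ (i + 1))) * inverse (of_nat (fact (i + 1))) :: complex fls)"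
    by (intro coeff_ge_mult coeff_ge_of_nat_inverse)
  then show "coeff_ge e 0 (inverse (2 ^ (i + 1)) / of_nat (fact (i + 1)) :: complex fls)"
    by (simp only: of_nat_power of_nat_numeral divide_inverse add_0_right)
qed

text \<open>The trace of the power - 2(i + 1) of \<Lambda> has order at least 2(i + 1), and the
  trace in Zbar has degree i + 1, each factor of weight \<open>k\<close>.\<close>

lemma order_ge_sqrt_exponent_term:
  assumes "\<And>a b. w (Inl (VZbar a b)) = k"
  shows "order_ge e w (int (Suc i) * (2 * int e + k))
    (mconst (- 1/2 * (1 / of_nat (Suc i) * tr_Lam_powi l (- int (2 * Suc i)))) * Zbar_trace (Suc i))"
proof -
  have "coeff_ge e (0 + int e * int (2 * Suc i))
      (- 1/2 * (1 / of_nat (Suc i)) * tr_Lam_powi l (- int (2 * Suc i)))"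
    by (intro coeff_ge_mult coeff_ge_rational coeff_ge_tr_Lam_powi)
  then have "order_ge e w ((0 + int e * int (2 * Suc i)) + int (Suc i) * k)
      (mconst (- 1/2 * (1 / of_nat (Suc i)) * tr_Lam_powi l (- int (2 * Suc i))) * Zbar_trace (Suc i))"
    using assms by (intro order_ge_mult order_ge_mconst order_ge_Zbar_trace)
  then show ?thesis by (simp only: mult.assoc) (simp add: algebra_simps)
qed

lemma order_ge_s_exponent_term:
  assumes "\<And>a b. w (Inl (VZbar a b)) = k"
  shows "order_ge e w (w (Inr i) + int (Suc i) * k)
    (mconst (inverse (2 ^ (i + 1)) / of_nat (fact (i + 1))) * mvar (Inr i) * Zbar_trace (Suc i))"
proof -
  have "order_ge e w ((0 + w (Inr i)) + int (Suc i) * k)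
    (mconst (inverse (2 ^ (i + 1)) / of_nat (fact (i + 1))) * mvar (Inr i) * Zbar_trace (Suc i))"
    using assms by (intro order_ge_mult order_ge_mconst order_ge_Zbar_trace order_ge_mvar coeff_ge_rational) auto
  then show ?thesis by simp
qed

lemma finite_nonzero_terms:
  assumes "\<And>i. order_ge 0 (\<lambda>_. 1) (int i) (F i)"
  shows "finite {i. mcoeff (F i) M \<noteq> 0}"
proof (rule finite_subset)
  show "{i. mcoeff (F i) M \<noteq> 0} \<subseteq> {..size M}"
    using order_ge_size_eq_0[OF assms, of M] by (force simp: not_le[symmetric])
qed simp

lemma mconst_mult_mSum:
  assumes "\<And>M. finite {i. mcoeff (F i) M \<noteq> 0}"
  shows "mconst c * mSum F = mSum (\<lambda>i. mconst c * F i)"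
  by (rule mfps_eqI) (simp add: mcoeff_mSum Sum_any_right_distrib[OF assms])

text \<open>The term bounds are positive multiples of \<open>2 * int e + k\<close>, so the least one
  is at \<open>i = 0\<close>. The case \<open>e = 0\<close>, \<open>k = 1\<close> restricts the
  support; the case \<open>e = 1\<close>, \<open>k = - 2\<close> is the borderline where order and
  Zbar degree balance.\<close>

lemma order_ge_sqrt_exponent:
  assumes w: "\<And>a b. w (Inl (VZbar a b)) = k" and "0 \<le> 2 * int e + k"
  shows "order_ge e w (2 * int e + k) (sqrt_exponent l)"
  unfolding sqrt_exponent_def
proof (rule order_ge_mSum, rule order_ge_mono[OF order_ge_sqrt_exponent_term])
  fix i
  show "2 * int e + k \<le> int (Suc i) * (2 * int e + k)"
    using mult_right_mono[of 1 "int (Suc i)" "2 * int e + k"] assms(2) by simp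
qed (rule w)

lemma order_ge_s_exponent:
  "(\<And>a b. w (Inl (VZbar a b)) = k) \<Longrightarrow> (\<And>i. j \<le> w (Inr i) + int (Suc i) * k) \<Longrightarrow> order_ge e w j s_exponent"
  unfolding s_exponent_def by (intro order_ge_mSum order_ge_mono[OF order_ge_s_exponent_term]) auto

text \<open>Besides the shift of the index, the factor - 1/2 moves into the infinite sum, which
  requires that each monomial meets finitely many terms; this holds since the \<open>i\<close>-th
  term has degree at least \<open>i\<close>.\<close>

lemma det_sqrt_eq:
  fixes l :: "(real, 'm :: finite) vec"
  shows "det_sqrt l (var_mat (\<lambda>a b :: 'n :: finite. Inl (VZbar a b) :: ('m, 'n) mat_var + nat)) =
    det (Lam l) ^ CARD('n) * mexp (sqrt_exponent l)"
proof -
  let ?c = "\<lambda>k. 1 / of_nat k * tr_Lam_powi l (- 2 * int k) :: complex fls"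
  have "mSum (\<lambda>k. if k \<ge> 1 then mconst (?c k) * Zbar_trace k else 0) =
      mSum (\<lambda>i. mconst (?c (Suc i)) * (Zbar_trace (Suc i) :: (('m, 'n) mat_var + nat, complex fls) mfps))"
    by (subst mSum_reindex_Suc) simp_all
  moreover have "mconst (- 1/2) * \<dots> = sqrt_exponent l"
  proof -
    have "finite {i. mcoeff (mconst (?c (Suc i)) * (Zbar_trace (Suc i) :: (('m, 'n) mat_var + nat, complex fls) mfps)) M \<noteq> 0}" for M
    proof (rule finite_nonzero_terms)
      fix i
      have "order_ge 0 (\<lambda>_. 1) (0 + int (Suc i) * 1) (mconst (?c (Suc i)) * (Zbar_trace (Suc i) :: (('m, 'n) mat_var + nat, complex fls) mfps))"
        by (intro order_ge_mult order_ge_mconst order_ge_Zbar_trace) (auto simp: coeff_ge_def)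
      then show "order_ge 0 (\<lambda>_. 1) (int i) (mconst (?c (Suc i)) * (Zbar_trace (Suc i) :: (('m, 'n) mat_var + nat, complex fls) mfps))"
        by (rule order_ge_mono) simp
    qed
    moreover have "- 2 * int (Suc i) = - int (2 * Suc i)" for i by simp
    ultimately show ?thesis
      by (simp only: mconst_mult_mSum sqrt_exponent_def mconst_mult mult.assoc)
  qed
  moreover have "- mconst (1/2) = (mconst (- 1/2) :: (('m, 'n) mat_var + nat, complex fls) mfps)"
    by (simp add: mconst_minus[symmetric])
  ultimately show ?thesis
    by (simp only: det_sqrt_def Zbar_trace_def)
qed

section \<open>Series free of the s variables and the vanishing of the total exponent\<close>

lemma mcoeff_mvar_mult: "mcoeff (mvar x * f) M = (if x \<in># M then mcoeff f (M - {#x#}) else 0)"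
proof -
  have "mcoeff (mvar x * f) M = (\<Sum>a\<in>{a. a \<subseteq># M}. if a = {#x#} then mcoeff f (M - {#x#}) else 0)"
    unfolding mcoeff_mult by (intro sum.cong) (auto simp: mcoeff_mvar)
  then show ?thesis by (simp add: finite_submultisets)
qed

definition s_free :: "(('m, 'n) mat_var + nat, complex fls) mfps \<Rightarrow> bool" where
  "s_free f \<longleftrightarrow> (\<forall>m s. mcoeff f (mset_plus m s) \<noteq> 0 \<longrightarrow> s = {#})"

text \<open>With weight - 1 on every \<open>s i\<close> and no positive weight elsewhere, a
  nonnegative total leaves no room for an \<open>s i\<close>.\<close>

lemma s_freeI:
  assumes "order_ge 0 (case_sum g (\<lambda>_. - 1)) 0 f" "\<And>x. g x \<le> 0"
  shows "s_free f"
  unfolding s_free_def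
proof safe
  fix m s assume "mcoeff f (mset_plus m s) \<noteq> 0"
  from order_geD[OF assms(1) this] have "0 \<le> (\<Sum>x\<in>#m. g x) + (\<Sum>i\<in>#s. - 1)"
    unfolding sum_mset_plus by simp
  moreover have "(\<Sum>x\<in>#m. g x) \<le> 0" using assms(2) by (induction m) (auto intro: add_nonpos_nonpos)
  moreover have "(\<Sum>i\<in>#s. - 1) = - int (size s)" by simp
  ultimately have "int (size s) \<le> 0" by linarith
  then show "s = {#}" by simp
qed

context s_subst
begin

lemma mcoeff_subst_s_free:
  assumes "order_ge 0 zs_wt 0 f" "s_free f"
  shows "mcoeff (subst f) m = mcoeff f (image_mset Inl m)"
proof -
  obtain T where T: "finite T" "\<And>s. mcoeff f (mset_plus m s) * (\<Prod>i\<in>#s. v i) \<noteq> 0 \<Longrightarrow> s \<in> T"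
    "mcoeff (subst f) m = (\<Sum>s\<in>T. mcoeff f (mset_plus m s) * (\<Prod>i\<in>#s. v i))"
    using mcoeff_subst_sum[OF assms(1)] by blast
  have "(\<Sum>s\<in>T. mcoeff f (mset_plus m s) * (\<Prod>i\<in>#s. v i)) =
      (\<Sum>s\<in>T. if s = {#} then mcoeff f (image_mset Inl m) else 0)"
    using assms(2) by (intro sum.cong) (auto simp: s_free_def)
  \<comment> \<open>If \<open>{#}\<close> is not in \<open>T\<close>, then \<open>T(2)\<close> says
    that this coefficient is 0.\<close>
  also have "\<dots> = mcoeff f (image_mset Inl m)"
    using T(1) T(2)[of "{#}"] by auto
  finally show ?thesis by (simp add: T(3))
qed

text \<open>The factor \<open>mvar (Inr i)\<close> alone has negative weight, so
  \<open>subst_mult\<close> cannot be applied to it; the product is treated as a whole, and only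
  \<open>s = {#i#}\<close> contributes.\<close>

lemma subst_mvar_mult_s_free:
  assumes "order_ge 0 zs_wt 0 (mvar (Inr i) * f)" "s_free f"
  shows "mcoeff (subst (mvar (Inr i) * f)) m = v i * mcoeff f (image_mset Inl m)"
proof -
  let ?g = "mvar (Inr i) * f"
  obtain T where T: "finite T" "\<And>s. mcoeff ?g (mset_plus m s) * (\<Prod>i\<in>#s. v i) \<noteq> 0 \<Longrightarrow> s \<in> T"
    "mcoeff (subst ?g) m = (\<Sum>s\<in>T. mcoeff ?g (mset_plus m s) * (\<Prod>i\<in>#s. v i))"
    using mcoeff_subst_sum[OF assms(1)] by blast
  have g: "mcoeff ?g (mset_plus m s) = (if s = {#i#} then mcoeff f (image_mset Inl m) else 0)" for s
  proof (cases "i \<in># s")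
    case True
    then obtain r where r: "s = add_mset i r" by (meson multi_member_split)
    have "mcoeff ?g (mset_plus m s) = mcoeff f (mset_plus m r)"
      by (simp add: mcoeff_mvar_mult r)
    also have "\<dots> = (if r = {#} then mcoeff f (image_mset Inl m) else 0)"
      using assms(2) by (auto simp: s_free_def)
    finally show ?thesis by (simp add: r)
  next
    case False
    then have "Inr i \<notin># mset_plus m s" by auto
    with False show ?thesis by (auto simp: mcoeff_mvar_mult)
  qed
  have "mcoeff (subst ?g) m = (\<Sum>s\<in>T. if s = {#i#} then v i * mcoeff f (image_mset Inl m) else 0)"
    unfolding T(3) by (intro sum.cong) (auto simp: g)
  also have "\<dots> = v i * mcoeff f (image_mset Inl m)"
  proof -
    have "v i * mcoeff f (image_mset Inl m) = 0" if "{#i#} \<notin> T"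
      using that T(2)[of "{#i#}"] unfolding g by (auto simp: mult.commute)
    then show ?thesis using T(1) by auto
  qed
  finally show ?thesis .
qed

end

lemma s_free_Zbar_trace: "s_free (Zbar_trace k)"
proof (rule s_freeI)
  show "order_ge 0 (case_sum (\<lambda>_. 0) (\<lambda>_. - 1)) 0 (Zbar_trace k)"
    using order_ge_Zbar_trace[of "case_sum (\<lambda>_. 0) (\<lambda>_. - 1)" 0 0 k] by simp
qed simp

lemma zs_wt_simps: "zs_wt (Inl (VZbar a b)) = 1" "zs_wt (Inl (VH i j)) = 0" "zs_wt (Inl (VZ a b)) = 0"
  "zs_wt (Inr k) = - int (Suc k)"
  by (simp_all add: zs_wt_def)

text \<open>Both exponents become sums over \<open>i\<close> of multiples of the same trace
  \<open>Zbar_trace (Suc i)\<close>, and they cancel term by term.\<close>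

lemma (in s_subst) subst_exponents:
  assumes v: "v = s_val l"
  shows "subst (sqrt_exponent l + s_exponent :: (('m :: finite, 'n :: finite) mat_var + nat, complex fls) mfps) = 0"
proof -
  let ?T = "Zbar_trace :: nat \<Rightarrow> (('m, 'n) mat_var + nat, complex fls) mfps"
  have T: "order_ge 0 zs_wt 0 (?T k)" for k
    by (rule order_ge_mono[OF order_ge_Zbar_trace[where k = 1]]) (simp_all add: zs_wt_simps)
  have 1: "mcoeff (subst (sqrt_exponent l)) m =
      Sum_any (\<lambda>i. - 1/2 * (1 / of_nat (Suc i) * tr_Lam_powi l (- int (2 * Suc i))) * mcoeff (?T (Suc i)) (image_mset Inl m))" for m
    unfolding sqrt_exponent_def
  proof (subst subst_mSum)
    show "finite {i. mcoeff (mconst (- 1/2 * (1 / of_nat (Suc i) * tr_Lam_powi l (- int (2 * Suc i)))) * ?T (Suc i)) M \<noteq> 0}" for M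
      by (rule finite_nonzero_terms) (rule order_ge_mono[OF order_ge_sqrt_exponent_term[where k = 1]], auto)
  qed (simp only: mcoeff_mSum subst_mconst_mult mcoeff_mconst_mult mcoeff_subst_s_free[OF T s_free_Zbar_trace])
  have 2: "mcoeff (subst s_exponent) m =
      Sum_any (\<lambda>i. inverse (2 ^ (i + 1)) / of_nat (fact (i + 1)) * (v i * mcoeff (?T (Suc i)) (image_mset Inl m)))" for m
    unfolding s_exponent_def
  proof (subst subst_mSum)
    show "finite {i. mcoeff (mconst (inverse (2 ^ (i + 1)) / of_nat (fact (i + 1))) * mvar (Inr i) * ?T (Suc i)) M \<noteq> 0}" for M
      by (rule finite_nonzero_terms) (rule order_ge_mono[OF order_ge_s_exponent_term[where k = 1]], auto)
    have "order_ge 0 zs_wt (- int (Suc i) + int (Suc i) * 1) (mvar (Inr i) * ?T (Suc i))" for i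
      by (intro order_ge_mult order_ge_mvar order_ge_Zbar_trace) (simp_all add: zs_wt_simps)
    then have M: "order_ge 0 zs_wt 0 (mvar (Inr i) * ?T (Suc i))" for i by simp
    show "mcoeff (mSum (\<lambda>i. subst (mconst (inverse (2 ^ (i + 1)) / of_nat (fact (i + 1))) * mvar (Inr i) * ?T (Suc i)))) m =
      Sum_any (\<lambda>i. inverse (2 ^ (i + 1)) / of_nat (fact (i + 1)) * (v i * mcoeff (?T (Suc i)) (image_mset Inl m)))"
      by (simp only: mcoeff_mSum mult.assoc subst_mconst_mult mcoeff_mconst_mult subst_mvar_mult_s_free[OF M s_free_Zbar_trace])
  qed
  have coeff: "inverse (2 ^ (i + 1)) / of_nat (fact (i + 1)) * (v i * x) =
      - (- 1/2 * (1 / of_nat (Suc i) * tr_Lam_powi l (- int (2 * Suc i))) * x)" for i x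
  proof -
    \<comment> \<open>Used with \<open>n = i + 1\<close>, \<open>f = i!\<close> and \<open>t\<close>
      the trace of the power - 2(i + 1) of \<Lambda>, so that \<open>n * f\<close> is the factorial
      of \<open>i + 1\<close>.\<close>
    have key: "inverse (2 ^ (i + 1)) / (n * f) * (2 ^ i * f * t * x) = - (- 1/2 * (1 / n * t) * x)"
      if "n \<noteq> 0" "f \<noteq> 0" for n f t :: "complex fls"
      using that by (simp add: field_simps)
    have "of_nat (fact (i + 1)) = (of_nat (Suc i) * of_nat (fact i) :: complex fls)"
      by (simp only: Suc_eq_plus1[symmetric] fact_Suc of_nat_id of_nat_mult)
    moreover have "- 2 * int i - 2 = - int (2 * Suc i)" by simp
    moreover have "of_nat (Suc i) \<noteq> (0 :: complex fls)" "of_nat (fact i) \<noteq> (0 :: complex fls)"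
      by (simp_all del: of_nat_Suc)
    ultimately show ?thesis
      unfolding v s_val_def by (simp only: key not_False_eq_True)
  qed
  show ?thesis
    unfolding subst_add
    by (rule mfps_eqI) (simp only: mcoeff_add 1 2 coeff Sum_any.expand_set neg_equal_0_iff_equal sum_negf
        add.right_inverse mcoeff_0)
qed

subsection \<open>The open partition function\<close>

text \<open>The two exponentials are merged into one so that the substitution meets a single
  exponent, which it sends to 0.\<close>

definition open_integrand ::
    "(real, 'm :: finite) vec \<Rightarrow> (('m, 'n :: finite) mat_var + nat, complex fls) mfps" where
  "open_integrand l = reduced_integrand l * mexp (sqrt_exponent l + s_exponent)"

lemma order_ge_exponents_size:
  "order_ge 0 (\<lambda>_. 1) 1 (sqrt_exponent l)" "order_ge 0 (\<lambda>_. 1) 1 s_exponent"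
  using order_ge_sqrt_exponent[of "\<lambda>_. 1" 1 0 l] order_ge_s_exponent[of "\<lambda>_. 1" 1 1 0] by simp_all

lemma Z_o_ext_s_eq:
  fixes l :: "(real, 'm :: {finite, linorder}) vec"
  shows "Z_o_ext_s TYPE('n :: finite) l = HZ_integral l (open_integrand l :: (('m, 'n) mat_var + nat, complex fls) mfps)"
proof -
  have "shifted_integrand l (\<lambda>i j. Inl (VH i j)) (\<lambda>H.
      mexp (mconst (1/6) * trace (mat_pow (var_mat (\<lambda>a b. Inl (VZ a b))) 3)) *
      (det_sqrt l (var_mat (\<lambda>a b. Inl (VZbar a b))) / det (kron (- H) (mat 1) - kron (mat 1) (var_mat (\<lambda>a b. Inl (VZ a b))))) *
      mexp (mSum (\<lambda>i. mconst (inverse (2 ^ (i + 1)) / of_nat (fact (i + 1))) *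
        mvar (Inr i) * trace (mat_pow (transpose (var_mat (\<lambda>a b. Inl (VZbar a b)))) (i + 1))))) =
      (open_integrand l :: (('m, 'n) mat_var + nat, complex fls) mfps)"
    unfolding open_integrand_def shifted_integrand_def reduced_integrand_def cubic_def det_sqrt_eq divide_mfps_def
      HZ_det_def[symmetric] s_exponent_def[unfolded Zbar_trace_def, symmetric, unfolded Suc_eq_plus1]
      mexp_add[OF order_ge_exponents_size]
    by (simp only: mult_ac)
  then show ?thesis
    unfolding Z_o_ext_s_def Let_def by (simp only:)
qed

section \<open>Integration of single monomials and the comparison of the two models\<close>

definition HZ_weight :: "(real, 'm :: {finite, linorder}) vec \<Rightarrow> ('m, 'n :: finite) mat_var multiset \<Rightarrow> complex fls" where
  "HZ_weight l m = fls_const (H_avg l (\<lambda>H. Z_avg (\<lambda>Z. \<Prod>v\<in>#m. mat_var_val H Z v))) *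
     fls_X ^ (size (filter_mset is_VH m) div 2)"

lemma HZ_weight_nonzero:
  fixes l :: "(real, 'm :: {finite, linorder}) vec"
  assumes "HZ_weight l m \<noteq> 0"
  shows "(\<Sum>v\<in>#m. charge v) = 0"
proof (rule ccontr)
  assume "(\<Sum>v\<in>#m. charge v) \<noteq> 0"
  then have "Z_avg (\<lambda>Z. \<Prod>v\<in>#m. mat_var_val H Z v) = 0" for H :: "(complex, 'm) sqmat"
    by (rule Z_avg_monomial_eq_0)
  then have "H_avg l (\<lambda>H. Z_avg (\<lambda>Z. \<Prod>v\<in>#m. mat_var_val H Z v)) = H_avg l (\<lambda>H. 0)"
    by (simp only:)
  also have "\<dots> = 0" by (simp add: H_avg_def)
  finally show False using assms by (simp add: HZ_weight_def)
qed

lemma HZ_weight_VH: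
  "HZ_weight l (image_mset (case_prod VH) m :: ('m :: {finite, linorder}, 'n :: finite) mat_var multiset) =
    fls_const (H_avg l (\<lambda>H. \<Prod>(i, j)\<in>#m. H $ i $ j)) * fls_X ^ (size m div 2)"
proof -
  have "(\<Prod>v\<in>#image_mset (case_prod VH) m. mat_var_val H Z v) = (\<Prod>(i, j)\<in>#m. H $ i $ j)"
    for H :: "(complex, 'm) sqmat" and Z :: "(complex, 'n) sqmat"
    by (induction m) auto
  moreover have "filter_mset is_VH (image_mset (case_prod VH) m) =
      (image_mset (case_prod VH) m :: ('m, 'n) mat_var multiset)"
    by (induction m) auto
  ultimately show ?thesis by (simp only: HZ_weight_def Z_avg_const size_image_mset)
qed

lemma sum_zbar_deg_nonneg: "0 \<le> (\<Sum>v\<in>#m. zbar_deg v)"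
proof (induction m)
  case (add v m)
  then show ?case by (cases v) auto
qed simp

text \<open>In a neutral monomial the absence of Zbar entails that of Z.\<close>

lemma multiset_only_VH:
  assumes "(\<Sum>v\<in>#m. zbar_deg v) = 0" "(\<Sum>v\<in>#m. charge v) = 0"
  shows "m \<in> range (image_mset (case_prod VH))"
proof -
  have "size (filter_mset is_VH m) = size m"
    using size_mat_var_multiset[of m] assms by simp
  then have "filter_mset is_VH m = m"
    by (metis less_irrefl mset_subset_size multiset_filter_subset subset_mset.le_less)
  then have "\<forall>v\<in>#m. is_VH v" by (metis filter_mset_eq_conv)
  then show ?thesis
  proof (induction m)
    case (add v m)
    then obtain m' i j where "m = image_mset (case_prod VH) m'" "v = VH i j"
      by (auto simp: is_VH_def)
    then have "add_mset v m = image_mset (case_prod VH) (add_mset (i, j) m')" by simp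
    then show ?case by blast
  qed (simp add: image_iff)
qed

lemma subdegree_HZ_weight:
  "HZ_weight l m \<noteq> 0 \<Longrightarrow> fls_subdegree (HZ_weight l m) = int (size (filter_mset is_VH m) div 2)"
  by (auto simp: HZ_weight_def)

lemma nth_nonzero_subdegree: "fls_nth f d \<noteq> 0 \<Longrightarrow> f \<noteq> 0 \<and> fls_subdegree f \<le> d"
  by (auto intro: fls_subdegree_leI)

lemma fls_nth_mult_const_X_power: "fls_nth (f * (fls_const c * fls_X ^ k)) d = c * fls_nth f (d - int k)"
  for f :: "complex fls"
proof -
  have "f * (fls_const c * fls_X ^ k) = fls_X ^ k * (fls_const c * f)" by (simp add: mult_ac)
  then show ?thesis by (simp only: fls_X_power_times_conv_shift) simp
qed

theorem theorem2:
  fixes l :: "real ^ ('m :: {finite, linorder})"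
  assumes "\<And>i. l $ i > 0"
  shows "Z_Kontsevich_Penner CARD('n :: finite) l = Z_o_ext TYPE('n) l"
proof -
  note pos = assms
  define F where "F = (open_integrand l :: (('m, 'n) mat_var + nat, complex fls) mfps)"
  define A where "A = (reduced_integrand l :: (('m, 'n) mat_var + nat, complex fls) mfps)"
  define W where "W = (HZ_weight l :: ('m, 'n) mat_var multiset \<Rightarrow> _)"
  define V where "V s = (\<Prod>i\<in>#s. s_val l i)" for s
  let ?z = "\<lambda>m :: ('m, 'n) mat_var multiset. \<Sum>v\<in>#m. zbar_deg v"
  let ?S = "\<lambda>s. \<Sum>i\<in>#s. int (Suc i)"
  let ?h = "\<lambda>m :: ('m, 'n) mat_var multiset. size (filter_mset is_VH m)"
  \<comment> \<open>The contribution of \<open>m\<close> to the coefficient of \<open>s\<close> in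
    the integral. Summing \<open>a s m * V s\<close> over \<open>m\<close> first gives the open
    partition function; summing over \<open>s\<close> first gives the integral of the substituted
    integrand.\<close>
  define a where "a s m = mcoeff F (mset_plus m s) * W m" for s m
  interpret S: s_subst "s_val l" .

  have A: "order_ge e w 0 A" if "\<And>i j. w (Inl (VH i j)) = 0" "\<And>a b. w (Inl (VZ a b)) = 0" for e w
    unfolding A_def using order_ge_reduced_integrand[where w = w and e = e, OF pos that] .
  have exponents: "order_ge 0 zs_wt 0 (sqrt_exponent l + s_exponent :: (('m, 'n) mat_var + nat, complex fls) mfps)"
    by (intro order_ge_add order_ge_mono[OF order_ge_sqrt_exponent[where k = 1]] order_ge_s_exponent[where k = 1])
       (simp_all add: zs_wt_simps)
  \<comment> \<open>Zbar has weight - 2 and \<open>s i\<close> has weight 2(i + 1). In the square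
    root this is balanced by the order of the traces of \<Lambda>, in the other exponent by the
    weight of \<open>s i\<close>.\<close>
  have exponents': "order_ge 1 (\<lambda>x. - 2 * zs_wt x) 0 (sqrt_exponent l + s_exponent :: (('m, 'n) mat_var + nat, complex fls) mfps)"
    by (intro order_ge_add order_ge_mono[OF order_ge_sqrt_exponent[where k = "- 2"]] order_ge_s_exponent[where k = "- 2"])
       (simp_all add: zs_wt_simps)
  have A_good: "order_ge 0 zs_wt 0 A" by (rule A) (simp_all add: zs_wt_simps)
  have F_good: "order_ge 0 zs_wt 0 F"
    unfolding F_def open_integrand_def A_def[symmetric]
    by (intro order_ge_mult_0 order_ge_mexp exponents A_good)
  have F_order: "order_ge 1 (\<lambda>x. - 2 * zs_wt x) 0 F"
    unfolding F_def open_integrand_def A_def[symmetric]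
    by (intro order_ge_mult_0 order_ge_mexp exponents' A) (simp_all add: zs_wt_simps)

  have "S.subst F = S.subst A * S.subst (mexp (sqrt_exponent l + s_exponent))"
    unfolding F_def open_integrand_def A_def[symmetric]
    by (intro S.subst_mult order_ge_mexp exponents A_good)
  also have "S.subst (mexp (sqrt_exponent l + s_exponent :: (('m, 'n) mat_var + nat, complex fls) mfps)) = 1"
    by (subst S.subst_mexp) (auto simp: S.subst_exponents mexp_0 exponents order_ge_exponents_size intro: order_ge_add)
  finally have subst_F: "S.subst F = S.subst A" by simp
  have "s_free A"
    by (rule s_freeI[where g = "\<lambda>_. 0"], rule A) auto
  then have mcoeff_subst_F: "mcoeff (S.subst F) m = mcoeff A (image_mset Inl m)" for m
    unfolding subst_F by (intro S.mcoeff_subst_s_free A_good)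
  have A_Zbar: "?z m = 0" if "mcoeff A (image_mset Inl m) \<noteq> 0" for m
  proof -
    \<comment> \<open>Giving Zbar a negative weight, which \<open>A\<close> permits, excludes it
      from the support.\<close>
    have "order_ge 0 (case_sum (\<lambda>x. - zbar_deg x) (\<lambda>_. 0)) 0 A" by (rule A) auto
    from order_geD[OF this that] have "0 \<le> (\<Sum>x\<in>#m. - zbar_deg x)"
      by (simp add: multiset.map_comp o_def)
    moreover have "(\<Sum>x\<in>#m. - zbar_deg x) = - ?z m" by (induction m) auto
    ultimately show ?thesis using sum_zbar_deg_nonneg[of m] by linarith
  qed

  \<comment> \<open>Each \<open>s i\<close> comes with i + 1 factors Zbar, and every Zbar in excess
    of these costs a power - 2 of \<Lambda>.\<close>
  have F_nonzero: "?S s \<le> ?z m" "2 * ?z m - 2 * ?S s \<le> fls_subdegree (mcoeff F (mset_plus m s))"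
    if "mcoeff F (mset_plus m s) \<noteq> 0" for m s
  proof -
    show "?S s \<le> ?z m" using order_geD[OF F_good that] unfolding sum_zs_wt by simp
    have "(\<Sum>x\<in>#M. - 2 * zs_wt x) = - 2 * (\<Sum>x\<in>#M. zs_wt x)" for M :: "(('m, 'n) mat_var + nat) multiset"
      by (induction M) auto
    with order_geD[OF F_order that] show "2 * ?z m - 2 * ?S s \<le> fls_subdegree (mcoeff F (mset_plus m s))"
      by (simp only: sum_zs_wt) simp
  qed
  have a_nonzero: "?S s \<le> ?z m" "2 * ?z m - 2 * ?S s + int (?h m div 2) \<le> d" "int (size m) = int (?h m) + 2 * ?z m"
    if "fls_nth (a s m) d \<noteq> 0" for s m d
  proof -
    have nz: "mcoeff F (mset_plus m s) \<noteq> 0" "W m \<noteq> 0" and d: "fls_subdegree (a s m) \<le> d"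
      using nth_nonzero_subdegree[OF that] by (auto simp: a_def)
    show "?S s \<le> ?z m" using F_nonzero(1)[OF nz(1)] .
    have "fls_subdegree (a s m) = fls_subdegree (mcoeff F (mset_plus m s)) + int (?h m div 2)"
      unfolding a_def using nz by (simp add: W_def subdegree_HZ_weight)
    with d F_nonzero(2)[OF nz(1)] show "2 * ?z m - 2 * ?S s + int (?h m div 2) \<le> d" by linarith
    show "int (size m) = int (?h m) + 2 * ?z m"
      using size_mat_var_multiset[of m] HZ_weight_nonzero[of l m] nz(2) by (simp add: W_def)
  qed
  have V: "\<exists>c. \<forall>f d. fls_nth (f * V s) d = c * fls_nth f (d - 2 * ?S s)" for s
  proof -
    obtain c where c: "V s = fls_const c * fls_X ^ (2 * (\<Sum>i\<in>#s. Suc i))"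
      using prod_s_val unfolding V_def by blast
    have "int (2 * (\<Sum>i\<in>#s. Suc i)) = 2 * ?S s" by (induction s) auto
    then show ?thesis unfolding c fls_nth_mult_const_X_power by auto
  qed
  \<comment> \<open>From \<open>h \<le> 2 * (D - 2 * z) + 1\<close>, where the 1 stems from rounding
    in \<open>h div 2\<close>, one gets \<open>h + 2 * z \<le> 2 * D + 1\<close>. The coarser bound
    stated here is sufficient.\<close>
  have bound: "k \<le> nat (3 * D + 1)" if "2 * z + int (h div 2) \<le> D" "int k = int h + 2 * z" "0 \<le> z"
    for k h :: nat and z D :: int
    using that by linarith
  \<comment> \<open>The factor \<open>V s\<close> raises the order by \<open>2 * ?S s\<close>, which
    removes \<open>s\<close> from the lower bound; what remains controls \<open>m\<close>, and
    \<open>?S s\<close> through the Zbar degree of \<open>m\<close>.\<close>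
  have aV_nonzero: "?S s \<le> d" "size m \<le> nat (3 * d + 1)" if "fls_nth (a s m * V s) d \<noteq> 0" for s m d
  proof -
    have "fls_nth (a s m) (d - 2 * ?S s) \<noteq> 0" using V[of s] that by auto
    note * = a_nonzero[OF this]
    then show "?S s \<le> d" "size m \<le> nat (3 * d + 1)" using sum_zbar_deg_nonneg[of m] by linarith+
  qed

  have HZ: "fls_nth (mcoeff (Z_o_ext_s TYPE('n) l) s * V s) d = Sum_any (\<lambda>m. fls_nth (a s m * V s) d)" for s d
  proof -
    \<comment> \<open>A lower bound on the exponents that is uniform in \<open>m\<close>, as
      required to read off the coefficients of \<open>fls_Sum\<close>.\<close>
    have a0: "fls_nth (a s m) d = 0" if "d < - 2 * ?S s" for m d
      using a_nonzero(2)[of s m d] that sum_zbar_deg_nonneg[of m] by fastforce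
    have "mcoeff (Z_o_ext_s TYPE('n) l) s = fls_Sum (a s)"
      by (simp add: Z_o_ext_s_eq HZ_integral_def a_def[abs_def] F_def W_def HZ_weight_def mult.assoc)
    then have nth: "fls_nth (mcoeff (Z_o_ext_s TYPE('n) l) s) d = Sum_any (\<lambda>m. fls_nth (a s m) d)" for d
      using fls_Sum_nth[OF a0] by simp
    have fin: "finite {m. fls_nth (a s m) d \<noteq> 0}" for d
    proof (rule finite_subset)
      show "{m. fls_nth (a s m) d \<noteq> 0} \<subseteq> {m. size m \<le> nat (3 * (d + 2 * ?S s) + 1)}"
      proof safe
        fix m assume "fls_nth (a s m) d \<noteq> 0"
        note * = a_nonzero[OF this]
        have "2 * ?z m + int (?h m div 2) \<le> d + 2 * ?S s" using *(2) by linarith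
        from bound[OF this *(3) sum_zbar_deg_nonneg] show "size m \<le> nat (3 * (d + 2 * ?S s) + 1)" .
      qed
    qed (rule finite_mat_var_multisets)
    obtain c where c: "\<And>f d. fls_nth (f * V s) d = c * fls_nth f (d - 2 * ?S s)"
      using V by blast
    show ?thesis unfolding c nth by (rule Sum_any_right_distrib[OF fin])
  qed

  \<comment> \<open>From here on the comparison takes place between coefficient functions under
    \<open>Abs_fls\<close>, one power of \<open>X\<close> at a time.\<close>
  have "Z_o_ext TYPE('n) l = Abs_fls (\<lambda>d. Sum_any (\<lambda>s. fls_nth (mcoeff (Z_o_ext_s TYPE('n) l) s * V s) d))"
    by (simp add: Z_o_ext_def msubst_def fls_Sum_def V_def s_val_def[abs_def])
  also have "\<dots> = Abs_fls (\<lambda>d. Sum_any (\<lambda>m. Sum_any (\<lambda>s. fls_nth (a s m * V s) d)))"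
  proof -
    have "Sum_any (\<lambda>s. Sum_any (\<lambda>m. fls_nth (a s m * V s) d)) = Sum_any (\<lambda>m. Sum_any (\<lambda>s. fls_nth (a s m * V s) d))" for d
    proof (rule Sum_any.swap)
      \<comment> \<open>For fixed \<open>d\<close> both index ranges are finite, independently of
        each other; this is what the order estimates were made for.\<close>
      show "finite ({s. ?S s \<le> d} \<times> {m :: ('m, 'n) mat_var multiset. size m \<le> nat (3 * d + 1)})"
        by (intro finite_cartesian_product finite_nat_multisets_weight finite_mat_var_multisets)
      show "{s. \<exists>m. fls_nth (a s m * V s) d \<noteq> 0} \<times> {m. \<exists>s. fls_nth (a s m * V s) d \<noteq> 0} \<subseteq>
          {s. ?S s \<le> d} \<times> {m. size m \<le> nat (3 * d + 1)}"
        using aV_nonzero by blast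
    qed
    then show ?thesis by (simp only: HZ)
  qed
  also have "\<dots> = Abs_fls (\<lambda>d. Sum_any (\<lambda>m. fls_nth (mcoeff (S.subst F) m * W m) d))"
  proof -
    have "Sum_any (\<lambda>s. fls_nth (a s m * V s) d) = fls_nth (mcoeff (S.subst F) m * W m) d" for m d
    proof -
      obtain T where T: "finite T" "\<And>s. mcoeff F (mset_plus m s) * V s \<noteq> 0 \<Longrightarrow> s \<in> T"
        "mcoeff (S.subst F) m = (\<Sum>s\<in>T. mcoeff F (mset_plus m s) * V s)"
        using S.mcoeff_subst_sum[OF F_good, of m] unfolding V_def by blast
      have aV: "a s m * V s = mcoeff F (mset_plus m s) * V s * W m" for s
        by (simp add: a_def mult_ac)
      have "Sum_any (\<lambda>s. fls_nth (a s m * V s) d) = (\<Sum>s\<in>T. fls_nth (a s m * V s) d)"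
      proof (rule Sum_any.expand_superset[OF T(1)], safe)
        fix s assume "fls_nth (a s m * V s) d \<noteq> 0"
        then have "mcoeff F (mset_plus m s) * V s \<noteq> 0" unfolding aV by auto
        then show "s \<in> T" by (rule T(2))
      qed
      also have "\<dots> = fls_nth (\<Sum>s\<in>T. a s m * V s) d"
        by (simp only: fls_nth_sum)
      also have "(\<Sum>s\<in>T. a s m * V s) = mcoeff (S.subst F) m * W m"
        by (simp add: T(3) aV sum_distrib_right)
      finally show ?thesis .
    qed
    then show ?thesis by (simp only:)
  qed
  also have "\<dots> = Abs_fls (\<lambda>d. Sum_any (\<lambda>m. fls_nth (mcoeff A (image_mset emb_H m) *
      fls_const (H_avg l (\<lambda>H. \<Prod>(i, j)\<in>#m. H $ i $ j)) * fls_X ^ (size m div 2)) d))"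
  proof -
    let ?i = "image_mset (case_prod VH) :: _ \<Rightarrow> ('m, 'n) mat_var multiset"
    have "inj (case_prod VH :: _ \<Rightarrow> ('m, 'n) mat_var)" by (auto simp: inj_on_def)
    then have inj: "inj ?i" by (rule multiset.inj_map)
    have emb: "image_mset Inl (?i m) = image_mset emb_H m" for m
      by (simp add: multiset.map_comp emb_H_def[abs_def] o_def case_prod_unfold)
    \<comment> \<open>A monomial containing Zbar is absent from \<open>A\<close>; one with Z but no
      Zbar is charged and integrates to 0. Only monomials in H remain.\<close>
    have "Sum_any (\<lambda>m. fls_nth (mcoeff A (image_mset Inl m) * W m) d) =
        Sum_any (\<lambda>m. fls_nth (mcoeff A (image_mset Inl (?i m)) * W (?i m)) d)" for d
    proof (rule Sum_any_reindex[OF inj])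
      fix m assume "m \<notin> range ?i"
      then have "?z m \<noteq> 0 \<or> (\<Sum>v\<in>#m. charge v) \<noteq> 0" using multiset_only_VH by blast
      then have "mcoeff A (image_mset Inl m) = 0 \<or> W m = 0"
        using A_Zbar HZ_weight_nonzero unfolding W_def by blast
      then show "fls_nth (mcoeff A (image_mset Inl m) * W m) d = 0" by auto
    qed
    then show ?thesis
      by (simp only: mcoeff_subst_F emb) (simp only: W_def HZ_weight_VH mult.assoc)
  qed
  also have "\<dots> = Z_Kontsevich_Penner CARD('n) l"
    unfolding Z_Kontsevich_Penner_def H_integral_def fls_Sum_def
      H_subst_reduced_integrand[OF pos, where 'n = 'n, symmetric] mcoeff_H_subst A_def ..
  finally show ?thesis ..
qed

end
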